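(* Let $n\ge2$, and suppose that the conditional weighted mean measure $\Lambda_z^w$ has a density $\lambda_w(z,\cdot)$ with respect to Lebesgue measure on $\overline\Omega_L$. Assume that $$\mathbb E\int_{\overline\Omega_L}\lambda_w(Z_1,u)^2\,du<\infty,\qquad\mathbb E\int_{\overline\Omega_L}\widehat\lambda^{(-1)}(Z_1,u)^2\,du<\infty.$$ Then, for every fixed candidate pair of bandwidths $(h_Z,h_U)$, $$\mathbb E\,\mathrm{CV}_n(h_Z,h_U)=R_{n-1}(h_Z,h_U)-C_0,$$ where $C_0=\mathbb E\int_{\overline\Omega_L}\lambda_w(Z_1,u)^2\,du$ does not depend on the bandwidths.
   Context: Fix $L>0$ and let $\Omega_L=\{(b,t):0\le b<t\le L\}$, $\overline\Omega_L=\{(b,t):0\le b\le t\le L\}$, $\Delta_L=\{(b,b):0\le b\le L\}$. A persistence diagram $D$ supported in $\Omega_L$ is identified with a locally finite counting measure $\mu_D=\sum_{x\in D}a_x\delta_x$, $a_x\in\mathbb N$. A weight is a measurable $w:\overline\Omega_L\to[0,\infty)$ with $w=0$ on $\Delta_L$; $\mu_D^w(A)=\int_Aw\,d\mu_D$ for Borel $A\subseteq\overline\Omega_L$. $(Z_i,D_i)$, $i=1,\dots,n$, are i.i.d. pairs, $Z_i\in\mathcal Z\subset\mathbb R^d$, $D_i$ a random persistence diagram; $\mu_i^w=\mu_{D_i}^w$ and $\Lambda_z^w(A)=\mathbb E[\mu_i^w(A)\mid Z_i=z]=\int_A\lambda_w(z,u)\,du$. Let $K_Z:\mathbb R^d\to[0,\infty)$,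 $K_U:\mathbb R^2\to[0,\infty)$ be kernels. For $h>0$ define $c_{Z,h}(z)=\int_{\mathcal Z}h^{-d}K_Z((z'-z)/h)\,dz'$, $c_{U,h}(u)=\int_{\overline\Omega_L}h^{-2}K_U((v-u)/h)\,dv$ (assumed finite and positive), $\kappa_{Z,h}(z,z')=h^{-d}K_Z((z'-z)/h)/c_{Z,h}(z)$, $\kappa_{U,h}(u,v)=h^{-2}K_U((v-u)/h)/c_{U,h}(u)$, $Y^w_{j,h_U}(u)=\int_{\overline\Omega_L}\kappa_{U,h_U}(u,v)\,d\mu_j^w(v)$. The leave-one-out estimator is $\widehat\lambda^{(-i)}(z,u)=\sum_{j\ne i}\kappa_{Z,h_Z}(z,Z_j)Y^w_{j,h_U}(u)/\sum_{j\ne i}\kappa_{Z,h_Z}(z,Z_j)$, equal to zero when the denominator is zero. Its risk is $R_{n-1}(h_Z,h_U)=\mathbb E\int_{\overline\Omega_L}(\widehat\lambda^{(-1)}(Z_1,u)-\lambda_w(Z_1,u))^2\,du$, and the criterion is $$\mathrm{CV}_n(h_Z,h_U)=\frac1n\sum_{i=1}^n\left\{\int_{\overline\Omega_L}\widehat\lambda^{(-i)}(Z_i,u)^2\,du-2\int_{\overline\Omega_L}\widehat\lambda^{(-i)}(Z_i,u)\,d\mu_i^w(u)\right\}.$$ *)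

theory Defs
  imports "HOL-Probability.Probability"
begin

definition Omega :: "real \<Rightarrow> (real \<times> real) set" where
  "Omega L = {(b, t). 0 \<le> b \<and> b < t \<and> t \<le> L}"

definition Omega_bar :: "real \<Rightarrow> (real \<times> real) set" where
  "Omega_bar L = {(b, t). 0 \<le> b \<and> b \<le> t \<and> t \<le> L}"

definition Diag :: "real \<Rightarrow> (real \<times> real) set" where
  "Diag L = {(b, b) | b. 0 \<le> b \<and> b \<le> L}"

abbreviation borel_bar :: "real \<Rightarrow> (real \<times> real) measure" where
  "borel_bar L \<equiv> restrict_space borel (Omega_bar L)"

abbreviation leb_bar :: "real \<Rightarrow> (real \<times> real) measure" where
  "leb_bar L \<equiv> restrict_space lborel (Omega_bar L)"


(* A persistence diagram is given by its multiplicities: D x is the coefficient a_x of the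
   point mass at x.  Local finiteness is relative to Omega L, so points may accumulate at the
   diagonal. *)
type_synonym diagram = "real \<times> real \<Rightarrow> nat"

definition diagrams :: "real \<Rightarrow> diagram set" where
  "diagrams L = {D. {x. D x \<noteq> 0} \<subseteq> Omega L \<and>
     (\<forall>C. compact C \<and> C \<subseteq> Omega L \<longrightarrow> finite {x \<in> C. D x \<noteq> 0})}"

(* The sum of D x times the point mass at x, as a Borel measure on Omega_bar L. *)
definition dgm_measure :: "real \<Rightarrow> diagram \<Rightarrow> (real \<times> real) measure" where
  "dgm_measure L D =
     distr (point_measure (Omega_bar L) (\<lambda>x. of_nat (D x))) (borel_bar L) (\<lambda>x. x)"

(* The smallest sigma-algebra making all evaluations of the counting measure on Borel sets
   measurable; a random persistence diagram is a random variable with values in this space. *)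
definition dgm_space :: "real \<Rightarrow> diagram measure" where
  "dgm_space L = (SUP A \<in> sets (borel_bar L).
     vimage_algebra (diagrams L) (\<lambda>D. emeasure (dgm_measure L D) A) borel)"

definition is_weight :: "real \<Rightarrow> (real \<times> real \<Rightarrow> real) \<Rightarrow> bool" where
  "is_weight L w \<longleftrightarrow> w \<in> borel_measurable (borel_bar L) \<and>
     (\<forall>u \<in> Omega_bar L. 0 \<le> w u) \<and> (\<forall>u \<in> Diag L. w u = 0)"

definition weighted_measure ::
    "real \<Rightarrow> (real \<times> real \<Rightarrow> real) \<Rightarrow> diagram \<Rightarrow> (real \<times> real) measure" where
  "weighted_measure L w D = density (dgm_measure L D) (\<lambda>u. ennreal (w u))"

(* The family Lam z is a version of the conditional mean measure of mu(D) given Z = z: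
   for every Borel A, evaluating Lam z A at z = Z gives the conditional expectation of
   mu(D)(A) with respect to the sigma-algebra generated by Z. *)
definition is_cond_mean_measure ::
    "'w measure \<Rightarrow> real \<Rightarrow> (real \<times> real \<Rightarrow> real) \<Rightarrow> 'z::topological_space set \<Rightarrow>
     ('w \<Rightarrow> 'z) \<Rightarrow> ('w \<Rightarrow> diagram) \<Rightarrow> ('z \<Rightarrow> (real \<times> real) measure) \<Rightarrow> bool" where
  "is_cond_mean_measure M L w ZZ Z D Lam \<longleftrightarrow>
     (\<forall>z \<in> ZZ. sets (Lam z) = sets (borel_bar L)) \<and>
     (\<forall>A \<in> sets (borel_bar L).
        (\<lambda>z. emeasure (Lam z) A) \<in> borel_measurable (restrict_space borel ZZ) \<and>
        (AE \<omega> in M. emeasure (Lam (Z \<omega>)) A =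
           nn_cond_exp M (vimage_algebra (space M) Z borel)
             (\<lambda>\<omega>. emeasure (weighted_measure L w (D \<omega>)) A) \<omega>))"

(* Used both for the covariates (S = ZZ, dimension d) and for the diagram plane
   (S = Omega_bar L, dimension 2). *)
definition scaled_kernel ::
    "('a::euclidean_space \<Rightarrow> real) \<Rightarrow> real \<Rightarrow> 'a \<Rightarrow> 'a \<Rightarrow> real" where
  "scaled_kernel K h z z' = K ((z' - z) /\<^sub>R h) / h ^ DIM('a)"

definition kernel_mass ::
    "('a::euclidean_space \<Rightarrow> real) \<Rightarrow> 'a set \<Rightarrow> real \<Rightarrow> 'a \<Rightarrow> real" where
  "kernel_mass K S h z = (LINT z':S|lborel. scaled_kernel K h z z')"

definition kappa ::
    "('a::euclidean_space \<Rightarrow> real) \<Rightarrow> 'a set \<Rightarrow> real \<Rightarrow> 'a \<Rightarrow> 'a \<Rightarrow> real" where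
  "kappa K S h z z' = scaled_kernel K h z z' / kernel_mass K S h z"

(* Integrability is required explicitly: the integral defining kernel_mass is 0 by convention
   when it diverges. *)
definition kernel_mass_ok ::
    "('a::euclidean_space \<Rightarrow> real) \<Rightarrow> 'a set \<Rightarrow> real \<Rightarrow> bool" where
  "kernel_mass_ok K S h \<longleftrightarrow>
     (\<forall>z \<in> S. set_integrable lborel S (scaled_kernel K h z) \<and> 0 < kernel_mass K S h z)"

(* A divergent integral counts as 0 here.  If the estimator, computed with the value infinity
   instead, has a finite second moment, this affects only a null set. *)
definition smoothed ::
    "real \<Rightarrow> (real \<times> real \<Rightarrow> real) \<Rightarrow> (real \<times> real \<Rightarrow> real) \<Rightarrow> real \<Rightarrow>
     diagram \<Rightarrow> real \<times> real \<Rightarrow> real" where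
  "smoothed L w KU hU D u =
     (\<integral>v. kappa KU (Omega_bar L) hU u v \<partial>weighted_measure L w D)"

(* The sample is zs j, ds j for j = 1, ..., n. *)
definition loo_estimator ::
    "real \<Rightarrow> (real \<times> real \<Rightarrow> real) \<Rightarrow> 'a::euclidean_space set \<Rightarrow>
     ('a \<Rightarrow> real) \<Rightarrow> (real \<times> real \<Rightarrow> real) \<Rightarrow> real \<Rightarrow> real \<Rightarrow>
     nat \<Rightarrow> (nat \<Rightarrow> 'a) \<Rightarrow> (nat \<Rightarrow> diagram) \<Rightarrow> nat \<Rightarrow> 'a \<Rightarrow> real \<times> real \<Rightarrow> real" where
  "loo_estimator L w ZZ KZ KU hZ hU n zs ds i z u =
     (let den = (\<Sum>j \<in> {1..n} - {i}. kappa KZ ZZ hZ z (zs j))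
      in if den = 0 then 0
         else (\<Sum>j \<in> {1..n} - {i}. kappa KZ ZZ hZ z (zs j) * smoothed L w KU hU (ds j) u) / den)"

definition CV ::
    "real \<Rightarrow> (real \<times> real \<Rightarrow> real) \<Rightarrow> 'a::euclidean_space set \<Rightarrow>
     ('a \<Rightarrow> real) \<Rightarrow> (real \<times> real \<Rightarrow> real) \<Rightarrow> real \<Rightarrow> real \<Rightarrow>
     nat \<Rightarrow> (nat \<Rightarrow> 'a) \<Rightarrow> (nat \<Rightarrow> diagram) \<Rightarrow> real" where
  "CV L w ZZ KZ KU hZ hU n zs ds =
     (\<Sum>i = 1..n.
        (\<integral>u. (loo_estimator L w ZZ KZ KU hZ hU n zs ds i (zs i) u)\<^sup>2 \<partial>leb_bar L)
        - 2 * (\<integral>u. loo_estimator L w ZZ KZ KU hZ hU n zs ds i (zs i) u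
                 \<partial>weighted_measure L w (ds i))) / real n"

(* The subscript n - 1 of R counts the observations used by the estimator; the argument n
   is the full sample size. *)
definition risk ::
    "'w measure \<Rightarrow> real \<Rightarrow> (real \<times> real \<Rightarrow> real) \<Rightarrow> 'a::euclidean_space set \<Rightarrow>
     ('a \<Rightarrow> real) \<Rightarrow> (real \<times> real \<Rightarrow> real) \<Rightarrow> real \<Rightarrow> real \<Rightarrow> nat \<Rightarrow>
     (nat \<Rightarrow> 'w \<Rightarrow> 'a) \<Rightarrow> (nat \<Rightarrow> 'w \<Rightarrow> diagram) \<Rightarrow> ('a \<Rightarrow> real \<times> real \<Rightarrow> real) \<Rightarrow> real" where
  "risk M L w ZZ KZ KU hZ hU n Z D lam =
     (\<integral>\<omega>. (\<integral>u. (loo_estimator L w ZZ KZ KU hZ hU n (\<lambda>j. Z j \<omega>) (\<lambda>j. D j \<omega>) 1 (Z 1 \<omega>) u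
                   - lam (Z 1 \<omega>) u)\<^sup>2 \<partial>leb_bar L) \<partial>M)"

definition C0 ::
    "'w measure \<Rightarrow> real \<Rightarrow> (nat \<Rightarrow> 'w \<Rightarrow> 'a) \<Rightarrow> ('a \<Rightarrow> real \<times> real \<Rightarrow> real) \<Rightarrow> real" where
  "C0 M L Z lam = (\<integral>\<omega>. (\<integral>u. (lam (Z 1 \<omega>) u)\<^sup>2 \<partial>leb_bar L) \<partial>M)"

end

theory Submission
  imports Defs
begin

text \<open>Expanding the square in the risk gives
\<open>E \<integral> f\<^sup>2 - 2 E \<integral> f \<lambda>(Z\<^sub>1, u) du + E \<integral> \<lambda>\<^sup>2\<close>, where \<open>f\<close> is the estimator computed
without the first observation and evaluated at \<open>Z\<^sub>1\<close>. The last term is the bandwidth-free constant.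
The criterion contains, in place of the cross term, the integral of the estimator against the
random measure of the left-out diagram, so everything rests on the identity
\<open>E \<integral> f d\<mu>\<^sub>1 = E \<integral> f \<lambda>(Z\<^sub>1, u) du\<close>
(\<open>nn_integral_loo_estimator_cond_mean\<close>). It holds because \<open>f\<close> depends on the first observation only
through \<open>Z\<^sub>1\<close>: once the other, independent observations are frozen, \<open>f\<close> becomes a deterministic
function of \<open>(Z\<^sub>1, u)\<close>, and integrating such a function against \<open>\<mu>\<^sub>1\<close> is, in expectation, the same as
integrating it against the conditional mean measure (\<open>nn_integral_cond_mean_measure\<close>). That last
fact is the definition of conditional expectation on products of a set of covariates and a set of
diagram points, and extends to all nonnegative functions because the conditional mean measure has
finite expected mass, its density being square integrable over a bounded set
(\<open>nn_integral_kernels_eqI\<close>).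

The summands of the criterion all have the same expectation, since a permutation of the
observations turns one into another and preserves their joint law (\<open>nn_integral_iid_permute\<close>).

The expectations are handled as integrals of nonnegative extended reals, where Fubini and
monotone convergence need no integrability. At the end the two moment assumptions, together with
\<open>ab \<le> a\<^sup>2 + b\<^sup>2\<close>, make all three terms finite, which allows the return to real-valued integrals.
Most of the measure-theoretic work is measurability in the diagram: its counting measure may have infinite
mass, and joint measurability is obtained from the compact sets on which this mass is finite
(\<open>measurable_nn_integral_dgm_measure\<close>).\<close>

section \<open>Measurability of integrals against random diagrams\<close>

lemma Omega_bar_borel [measurable]: "Omega_bar L \<in> sets borel"
proof -
  have "closed (Omega_bar L)"
    unfolding Omega_bar_def case_prod_beta
    by (intro closed_Collect_conj closed_Collect_le continuous_intros)
  then show ?thesis by simp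
qed

lemma space_dgm_space: "space (dgm_space L) = diagrams L"
  unfolding dgm_space_def by (auto simp: space_Sup_eq_UN)

lemma sets_dgm_measure [measurable_cong, simp]: "sets (dgm_measure L D) = sets (borel_bar L)"
  by (simp add: dgm_measure_def)

lemma space_dgm_measure [simp]: "space (dgm_measure L D) = Omega_bar L"
  by (simp add: dgm_measure_def space_restrict_space)

lemma emeasure_dgm_measure_measurable [measurable]:
  assumes "A \<in> sets (borel_bar L)"
  shows "(\<lambda>D. emeasure (dgm_measure L D) A) \<in> borel_measurable (dgm_space L)"
  unfolding dgm_space_def
  by (rule measurable_SUP1[OF assms]) (auto intro: measurable_vimage_algebra1)

lemma nn_integral_dgm_measure:
  assumes [measurable]: "f \<in> borel_measurable (borel_bar L)"
  shows "(\<integral>\<^sup>+u. f u \<partial>dgm_measure L D) =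
    (\<integral>\<^sup>+u. of_nat (D u) * f u \<partial>count_space (Omega_bar L))"
proof -
  have "(\<lambda>x. x) \<in> measurable (point_measure (Omega_bar L) (\<lambda>x. of_nat (D x))) (borel_bar L)"
    by (auto simp: measurable_def space_point_measure sets_point_measure space_restrict_space)
  then show ?thesis
    unfolding dgm_measure_def
    by (simp add: nn_integral_distr point_measure_def nn_integral_density)
qed

text \<open>Only away from the diagonal is the mass of a diagram guaranteed to be finite. These compact sets exhaust
\<^term>\<open>Omega L\<close>, which makes the counting measures of all diagrams simultaneously
sigma-finite.\<close>

definition off_diagonal :: "real \<Rightarrow> nat \<Rightarrow> (real \<times> real) set" where
  "off_diagonal L k = {(b, t). 0 \<le> b \<and> b + inverse (real (Suc k)) \<le> t \<and> t \<le> L}"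

lemma off_diagonal_subset: "off_diagonal L k \<subseteq> Omega L"
proof -
  have "b < t" if "b + inverse (real (Suc k)) \<le> t" for b t :: real
  proof -
    have "0 < inverse (real (Suc k))" by simp
    then show ?thesis using that by linarith
  qed
  then show ?thesis unfolding off_diagonal_def Omega_def by blast
qed

lemma compact_off_diagonal: "compact (off_diagonal L k)"
proof (rule compact_Int_closed[where T = "off_diagonal L k", THEN back_subst[of compact]])
  show "compact ({0..L} \<times> {0..L})" by (intro compact_Times compact_Icc)
  show "closed (off_diagonal L k)"
    unfolding off_diagonal_def case_prod_beta
    by (intro closed_Collect_conj closed_Collect_le continuous_intros)
  show "({0..L} \<times> {0..L}) \<inter> off_diagonal L k = off_diagonal L k"
    using off_diagonal_subset[of L k] by (auto simp: Omega_def)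
qed

lemma Omega_subset: "Omega L \<subseteq> Omega_bar L"
  by (auto simp: Omega_def Omega_bar_def)

lemma off_diagonal_sets [measurable]: "off_diagonal L k \<in> sets (borel_bar L)"
  using off_diagonal_subset[of L k] Omega_subset[of L] compact_off_diagonal[of L k]
  by (auto simp: sets_restrict_space_iff compact_imp_closed)

lemma incseq_off_diagonal: "incseq (off_diagonal L)"
proof (rule incseq_SucI)
  fix k
  have "inverse (real (Suc (Suc k))) \<le> inverse (real (Suc k))" by (intro le_imp_inverse_le) auto
  then have "b + inverse (real (Suc (Suc k))) \<le> t" if "b + inverse (real (Suc k)) \<le> t" for b t
    using that by linarith
  then show "off_diagonal L k \<subseteq> off_diagonal L (Suc k)"
    unfolding off_diagonal_def by blast
qed

lemma UN_off_diagonal: "(\<Union>k. off_diagonal L k) = Omega L"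
proof
  show "(\<Union>k. off_diagonal L k) \<subseteq> Omega L" using off_diagonal_subset by blast
  show "Omega L \<subseteq> (\<Union>k. off_diagonal L k)"
  proof
    fix x assume "x \<in> Omega L"
    then obtain b t where x: "x = (b, t)" "0 \<le> b" "b < t" "t \<le> L" by (auto simp: Omega_def)
    obtain k where "inverse (real (Suc k)) < t - b" using reals_Archimedean[of "t - b"] x by auto
    then have "x \<in> off_diagonal L k" using x by (auto simp: off_diagonal_def)
    then show "x \<in> (\<Union>k. off_diagonal L k)" by blast
  qed
qed

lemma emeasure_dgm_off_diagonal_finite:
  assumes "D \<in> diagrams L"
  shows "emeasure (dgm_measure L D) (off_diagonal L k) < \<infinity>"
proof -
  let ?F = "{x \<in> off_diagonal L k. D x \<noteq> 0}"
  have fin: "finite ?F"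
    using assms compact_off_diagonal[of L k] off_diagonal_subset[of L k]
    unfolding diagrams_def mem_Collect_eq by blast
  have "emeasure (dgm_measure L D) (off_diagonal L k) =
      (\<integral>\<^sup>+u. of_nat (D u) * indicator (off_diagonal L k) u \<partial>count_space (Omega_bar L))"
    by (subst nn_integral_dgm_measure[symmetric]) (auto simp: off_diagonal_sets)
  also have "\<dots> = (\<Sum>u\<in>?F. of_nat (D u))"
    using off_diagonal_subset[of L k] Omega_subset[of L] fin
    by (subst nn_integral_count_space'[where A = ?F])
       (auto simp: indicator_def split: if_splits)
  also have "\<dots> < \<infinity>" by (simp flip: of_nat_sum add: of_nat_less_top)
  finally show ?thesis .
qed

text \<open>A diagram puts no mass outside \<^term>\<open>Omega L\<close>, so this is monotone convergence
along the exhaustion.\<close>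

lemma nn_integral_dgm_measure_SUP:
  assumes D: "D \<in> diagrams L" and [measurable]: "f \<in> borel_measurable (borel_bar L)"
  shows "(\<integral>\<^sup>+u. f u \<partial>dgm_measure L D) =
    (SUP k. \<integral>\<^sup>+u. indicator (off_diagonal L k) u * f u \<partial>dgm_measure L D)"
proof -
  have "(\<integral>\<^sup>+u. f u \<partial>dgm_measure L D) =
      (\<integral>\<^sup>+u. indicator (\<Union>k. off_diagonal L k) u * f u \<partial>dgm_measure L D)"
  proof (subst (1 2) nn_integral_dgm_measure)
    have "D u = 0" if "u \<notin> Omega L" for u
      using D that by (auto simp: diagrams_def)
    then show "(\<integral>\<^sup>+u. of_nat (D u) * f u \<partial>count_space (Omega_bar L)) =
        (\<integral>\<^sup>+u. of_nat (D u) * (indicator (\<Union>k. off_diagonal L k) u * f u) \<partial>count_space (Omega_bar L))"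
      unfolding UN_off_diagonal by (intro nn_integral_cong) (auto simp: indicator_def)
  qed measurable
  also have "\<dots> = (\<integral>\<^sup>+u. (SUP k. indicator (off_diagonal L k) u * f u) \<partial>dgm_measure L D)"
  proof (rule nn_integral_cong)
    fix u
    have "indicator (\<Union>k. off_diagonal L k) u * f u \<le> (SUP k. indicator (off_diagonal L k) u * f u)"
    proof (cases "u \<in> (\<Union>k. off_diagonal L k)")
      case True
      then obtain k where "u \<in> off_diagonal L k" by blast
      then show ?thesis by (intro SUP_upper2[of k]) (auto simp: indicator_def)
    qed simp
    moreover have "(SUP k. indicator (off_diagonal L k) u * f u) \<le>
        indicator (\<Union>k. off_diagonal L k) u * f u"
      by (intro SUP_least) (auto simp: indicator_def)
    ultimately show "indicator (\<Union>k. off_diagonal L k) u * f u =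
        (SUP k. indicator (off_diagonal L k) u * f u)"
      by (rule antisym)
  qed
  also have "\<dots> = (SUP k. \<integral>\<^sup>+u. indicator (off_diagonal L k) u * f u \<partial>dgm_measure L D)"
  proof (rule nn_integral_monotone_convergence_SUP)
    show "incseq (\<lambda>k u. indicator (off_diagonal L k) u * f u)"
      using incseq_off_diagonal[of L]
      by (auto simp: incseq_def le_fun_def indicator_def subset_eq)
  qed measurable
  finally show ?thesis .
qed

text \<open>The sigma-algebra on diagrams only makes the evaluations at fixed sets measurable. Restricting
the counting measure to one set of the exhaustion and dividing by one plus its mass there gives
a sub-probability kernel, for which joint measurability is known; undoing the normalisation and
passing to the supremum gives the general case.\<close>

lemma measurable_nn_integral_dgm_measure:
  assumes L: "0 \<le> L"
    and f [measurable]: "(\<lambda>(x, u). f x u) \<in> borel_measurable (N \<Otimes>\<^sub>M borel_bar L)"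
    and D [measurable]: "D \<in> measurable N (dgm_space L)"
  shows "(\<lambda>x. \<integral>\<^sup>+u. f x u \<partial>dgm_measure L (D x)) \<in> borel_measurable N"
proof -
  have dia: "D x \<in> diagrams L" if "x \<in> space N" for x
    using measurable_space[OF D that] by (simp add: space_dgm_space)
  \<comment> \<open>The summand 1 keeps the normalising constant away from 0 for diagrams with no point in the set.\<close>
  define c where "c k x = 1 + emeasure (dgm_measure L (D x)) (off_diagonal L k)" for k x
  have c_meas [measurable]: "c k \<in> borel_measurable N" for k
    unfolding c_def by measurable
  have c: "c k x \<noteq> 0" "c k x \<noteq> \<infinity>" if "x \<in> space N" for k x
    using emeasure_dgm_off_diagonal_finite[OF dia[OF that], of k] by (auto simp: c_def)
  define \<kappa> where "\<kappa> k x = density (dgm_measure L (D x))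
    (\<lambda>u. indicator (off_diagonal L k) u / c k x)" for k x
  have em: "emeasure (\<kappa> k x) A =
      emeasure (dgm_measure L (D x)) (off_diagonal L k \<inter> A) / c k x"
    if A [measurable]: "A \<in> sets (borel_bar L)" for k x A
  proof -
    have "emeasure (\<kappa> k x) A =
        (\<integral>\<^sup>+u. indicator (off_diagonal L k \<inter> A) u / c k x \<partial>dgm_measure L (D x))"
      unfolding \<kappa>_def by (subst emeasure_density)
        (auto intro!: nn_integral_cong simp: indicator_def)
    also have "\<dots> = emeasure (dgm_measure L (D x)) (off_diagonal L k \<inter> A) / c k x"
      by (subst nn_integral_divide) auto
    finally show ?thesis .
  qed
  have kernel [measurable]: "\<kappa> k \<in> measurable N (subprob_algebra (borel_bar L))" for k
  proof (rule measurable_subprob_algebra)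
    fix x assume x: "x \<in> space N"
    show "sets (\<kappa> k x) = sets (borel_bar L)" by (simp add: \<kappa>_def)
    have sp: "space (\<kappa> k x) = Omega_bar L" by (simp add: \<kappa>_def)
    show "subprob_space (\<kappa> k x)"
    proof
      have "off_diagonal L k \<inter> Omega_bar L = off_diagonal L k"
        using off_diagonal_subset[of L k] Omega_subset[of L] by blast
      moreover have "Omega_bar L \<in> sets (borel_bar L)"
        by (metis sets.top space_dgm_measure sets_dgm_measure)
      ultimately have "emeasure (\<kappa> k x) (space (\<kappa> k x)) =
          emeasure (dgm_measure L (D x)) (off_diagonal L k) / c k x"
        by (simp add: em sp)
      also have "\<dots> \<le> c k x / c k x"
        by (intro divide_right_mono_ennreal) (simp add: c_def)
      also have "\<dots> = 1" using c[OF x, of k] by (simp add: ennreal_divide_self top.not_eq_extremum)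
      finally show "emeasure (\<kappa> k x) (space (\<kappa> k x)) \<le> 1" .
      show "space (\<kappa> k x) \<noteq> {}" using L unfolding sp Omega_bar_def by auto
    qed
  next
    fix A assume [measurable]: "A \<in> sets (borel_bar L)"
    show "(\<lambda>x. emeasure (\<kappa> k x) A) \<in> borel_measurable N"
      unfolding em[OF \<open>A \<in> sets (borel_bar L)\<close>] by measurable
  qed
  have "(\<lambda>x. SUP k. c k x * (\<integral>\<^sup>+u. f x u \<partial>\<kappa> k x)) \<in> borel_measurable N"
    by (intro borel_measurable_SUP borel_measurable_times_ennreal c_meas
        nn_integral_measurable_subprob_algebra2[OF f kernel]) auto
  also have "?this \<longleftrightarrow> ?thesis"
  proof (rule measurable_cong)
    fix x assume x: "x \<in> space N"
    have [measurable]: "f x \<in> borel_measurable (borel_bar L)"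
      using measurable_Pair2[OF f x] by simp
    have "c k x * (\<integral>\<^sup>+u. f x u \<partial>\<kappa> k x) =
        (\<integral>\<^sup>+u. indicator (off_diagonal L k) u * f x u \<partial>dgm_measure L (D x))" for k
    proof -
      have "c k x * (\<integral>\<^sup>+u. f x u \<partial>\<kappa> k x) =
          (\<integral>\<^sup>+u. c k x * (indicator (off_diagonal L k) u / c k x * f x u) \<partial>dgm_measure L (D x))"
        unfolding \<kappa>_def by (subst nn_integral_density) (auto simp: nn_integral_cmult)
      also have "\<dots> = (\<integral>\<^sup>+u. indicator (off_diagonal L k) u * f x u \<partial>dgm_measure L (D x))"
      proof (rule nn_integral_cong)
        fix u
        have "c k x * (y / c k x) = y" for y
          using c[OF x, of k] ennreal_mult_divide_eq[of "c k x" y]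
          by (simp add: ennreal_times_divide mult.commute)
        then show "c k x * (indicator (off_diagonal L k) u / c k x * f x u) =
            indicator (off_diagonal L k) u * f x u"
          by (simp add: mult.assoc[symmetric])
      qed
      finally show ?thesis .
    qed
    then show "(SUP k. c k x * (\<integral>\<^sup>+u. f x u \<partial>\<kappa> k x)) = (\<integral>\<^sup>+u. f x u \<partial>dgm_measure L (D x))"
      by (simp add: nn_integral_dgm_measure_SUP[OF dia[OF x], of "f x"])
  qed
  finally show ?thesis .
qed

lemma sets_weighted_measure [measurable_cong, simp]:
  "sets (weighted_measure L w D) = sets (borel_bar L)"
  by (simp add: weighted_measure_def)

lemma space_weighted_measure [simp]: "space (weighted_measure L w D) = Omega_bar L"
  by (simp add: weighted_measure_def)

lemma measurable_nn_integral_weighted_measure: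
  assumes "0 \<le> L" and w: "is_weight L w"
    and [measurable]: "(\<lambda>(x, u). f x u) \<in> borel_measurable (N \<Otimes>\<^sub>M borel_bar L)"
      "D \<in> measurable N (dgm_space L)"
  shows "(\<lambda>x. \<integral>\<^sup>+u. f x u \<partial>weighted_measure L w (D x)) \<in> borel_measurable N"
proof -
  have [measurable]: "w \<in> borel_measurable (borel_bar L)" using w by (simp add: is_weight_def)
  have "(\<lambda>x. \<integral>\<^sup>+u. ennreal (w u) * f x u \<partial>dgm_measure L (D x)) \<in> borel_measurable N"
    by (rule measurable_nn_integral_dgm_measure[OF \<open>0 \<le> L\<close>]) measurable
  then show ?thesis
    unfolding weighted_measure_def by (subst measurable_cong, subst nn_integral_density) auto
qed

lemma sets_leb_bar: "sets (leb_bar L) = sets (borel_bar L)"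
  by (intro sets_restrict_space_cong) simp

lemma finite_measure_leb_bar: "finite_measure (leb_bar L)"
proof
  have "Omega_bar L \<subseteq> cbox (0, 0) (L, L)" by (auto simp: Omega_bar_def cbox_Pair_eq)
  then have "bounded (Omega_bar L)" using bounded_cbox bounded_subset by blast
  then have "emeasure lborel (Omega_bar L) < \<infinity>" by (rule emeasure_bounded_finite)
  then show "emeasure (leb_bar L) (space (leb_bar L)) \<noteq> \<infinity>"
    by (subst emeasure_restrict_space) (auto simp: space_restrict_space)
qed

lemma measurable_nn_integral_leb_bar:
  assumes "(\<lambda>(x, u). f x u) \<in> borel_measurable (N \<Otimes>\<^sub>M borel_bar L)"
  shows "(\<lambda>x. \<integral>\<^sup>+u. f x u \<partial>leb_bar L) \<in> borel_measurable N"
proof -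
  interpret finite_measure "leb_bar L" by (rule finite_measure_leb_bar)
  have "(\<lambda>(x, u). f x u) \<in> borel_measurable (N \<Otimes>\<^sub>M leb_bar L)"
    using assms measurable_cong_sets[OF sets_pair_measure_cong[OF refl sets_leb_bar] refl] by blast
  then show ?thesis by measurable
qed

section \<open>Integrals against the conditional mean measure\<close>

text \<open>Averaged over \<^term>\<open>M\<close>, each kernel defines a measure on the product of
\<^term>\<open>S\<close> and \<^term>\<open>N\<close>. The two measures agree on rectangles,
which are closed under intersection and generate the product; finiteness of the second one
allows complements in the Dynkin argument.\<close>

lemma nn_integral_kernels_eqI:
  fixes k k' :: "'a \<Rightarrow> 'b measure" and h :: "'c \<times> 'b \<Rightarrow> ennreal"
  assumes X [measurable]: "X \<in> measurable M S"
    and sets: "\<And>\<omega>. \<omega> \<in> space M \<Longrightarrow> sets (k \<omega>) = sets N" "\<And>\<omega>. \<omega> \<in> space M \<Longrightarrow> sets (k' \<omega>) = sets N"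
    and meas: "\<And>f. f \<in> borel_measurable (S \<Otimes>\<^sub>M N) \<Longrightarrow>
        (\<lambda>\<omega>. \<integral>\<^sup>+u. f (X \<omega>, u) \<partial>k \<omega>) \<in> borel_measurable M"
      "\<And>f. f \<in> borel_measurable (S \<Otimes>\<^sub>M N) \<Longrightarrow>
        (\<lambda>\<omega>. \<integral>\<^sup>+u. f (X \<omega>, u) \<partial>k' \<omega>) \<in> borel_measurable M"
    and rect: "\<And>B A. B \<in> sets S \<Longrightarrow> A \<in> sets N \<Longrightarrow>
        (\<integral>\<^sup>+\<omega>. indicator B (X \<omega>) * emeasure (k \<omega>) A \<partial>M) =
        (\<integral>\<^sup>+\<omega>. indicator B (X \<omega>) * emeasure (k' \<omega>) A \<partial>M)"
    and fin: "(\<integral>\<^sup>+\<omega>. emeasure (k' \<omega>) (space N) \<partial>M) < \<infinity>"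
    and h: "h \<in> borel_measurable (S \<Otimes>\<^sub>M N)"
  shows "(\<integral>\<^sup>+\<omega>. \<integral>\<^sup>+u. h (X \<omega>, u) \<partial>k \<omega> \<partial>M) = (\<integral>\<^sup>+\<omega>. \<integral>\<^sup>+u. h (X \<omega>, u) \<partial>k' \<omega> \<partial>M)"
proof -
  have Xs: "X \<omega> \<in> space S" if "\<omega> \<in> space M" for \<omega> using measurable_space[OF X that] .
  have sec: "(\<lambda>u. f (X \<omega>, u)) \<in> borel_measurable (k \<omega>)" "(\<lambda>u. f (X \<omega>, u)) \<in> borel_measurable (k' \<omega>)"
    if "\<omega> \<in> space M" "f \<in> borel_measurable (S \<Otimes>\<^sub>M N)" for f :: "'c \<times> 'b \<Rightarrow> ennreal" and \<omega>
    using measurable_Pair2[OF that(2) Xs[OF that(1)]] sets[OF that(1)]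
    by (auto cong: measurable_cong_sets)
  define I where "I f = (\<integral>\<^sup>+\<omega>. \<integral>\<^sup>+u. f (X \<omega>, u) \<partial>k \<omega> \<partial>M)" for f :: "'c \<times> 'b \<Rightarrow> ennreal"
  define J where "J f = (\<integral>\<^sup>+\<omega>. \<integral>\<^sup>+u. f (X \<omega>, u) \<partial>k' \<omega> \<partial>M)" for f :: "'c \<times> 'b \<Rightarrow> ennreal"
  have IJ_add: "I (\<lambda>p. f p + g p) = I f + I g" "J (\<lambda>p. f p + g p) = J f + J g"
    if "f \<in> borel_measurable (S \<Otimes>\<^sub>M N)" "g \<in> borel_measurable (S \<Otimes>\<^sub>M N)" for f g
    unfolding I_def J_def
    using that by (subst nn_integral_add[symmetric],
        auto intro!: nn_integral_cong nn_integral_add sec meas)+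
  have cmult: "I (\<lambda>p. c * f p) = c * I f" "J (\<lambda>p. c * f p) = c * J f"
    if "f \<in> borel_measurable (S \<Otimes>\<^sub>M N)" for f c
    unfolding I_def J_def
    using that by (subst nn_integral_cmult[symmetric],
        auto intro!: nn_integral_cong nn_integral_cmult sec meas)+
  have SUP: "I (\<lambda>p. SUP i. F i p) = (SUP i. I (F i))" "J (\<lambda>p. SUP i. F i p) = (SUP i. J (F i))"
    if F: "\<And>i. F i \<in> borel_measurable (S \<Otimes>\<^sub>M N)" and inc: "incseq F" for F :: "nat \<Rightarrow> 'c \<times> 'b \<Rightarrow> ennreal"
  proof -
    have inc1: "incseq (\<lambda>i u. F i (x, u))" for x
      using inc by (auto simp: incseq_def le_fun_def)
    have inc2: "incseq (\<lambda>i \<omega>. \<integral>\<^sup>+u. F i (X \<omega>, u) \<partial>kk \<omega>)" for kk :: "'a \<Rightarrow> 'b measure"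
      using inc by (auto simp: incseq_def le_fun_def intro!: nn_integral_mono)
    show "I (\<lambda>p. SUP i. F i p) = (SUP i. I (F i))"
      unfolding I_def
      by (subst nn_integral_monotone_convergence_SUP[symmetric, OF inc2 meas(1)[OF F]])
         (auto intro!: nn_integral_cong nn_integral_monotone_convergence_SUP inc1 sec F)
    show "J (\<lambda>p. SUP i. F i p) = (SUP i. J (F i))"
      unfolding J_def
      by (subst nn_integral_monotone_convergence_SUP[symmetric, OF inc2 meas(2)[OF F]])
         (auto intro!: nn_integral_cong nn_integral_monotone_convergence_SUP inc1 sec F)
  qed
  have IJ_cong: "I f = I g" "J f = J g" if "\<And>p. p \<in> space (S \<Otimes>\<^sub>M N) \<Longrightarrow> f p = g p" for f g
    unfolding I_def J_def using that Xs sets[THEN sets_eq_imp_space_eq]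
    by (auto intro!: nn_integral_cong simp: space_pair_measure)
  have rects: "I (indicator (B \<times> A)) = J (indicator (B \<times> A))" if "B \<in> sets S" "A \<in> sets N" for A B
  proof -
    have *: "(\<integral>\<^sup>+\<omega>. \<integral>\<^sup>+u. indicator (B \<times> A) (X \<omega>, u) \<partial>kk \<omega> \<partial>M) =
        (\<integral>\<^sup>+\<omega>. indicator B (X \<omega>) * emeasure (kk \<omega>) A \<partial>M)"
      if "\<And>\<omega>. \<omega> \<in> space M \<Longrightarrow> sets (kk \<omega>) = sets N" for kk :: "'a \<Rightarrow> 'b measure"
      using that \<open>A \<in> sets N\<close>
      by (auto intro!: nn_integral_cong simp: indicator_times nn_integral_cmult_indicator)
    show ?thesis unfolding I_def J_def using * sets rect[OF that] by simp
  qed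
  have Jfin: "J (indicator (space (S \<Otimes>\<^sub>M N))) < \<infinity>"
  proof -
    have "J (indicator (space (S \<Otimes>\<^sub>M N))) = (\<integral>\<^sup>+\<omega>. emeasure (k' \<omega>) (space N) \<partial>M)"
      unfolding J_def using Xs sets(2)
      by (auto intro!: nn_integral_cong simp: space_pair_measure indicator_times)
    then show ?thesis using fin by simp
  qed
  have ind: "I (indicator Q) = J (indicator Q)" if "Q \<in> sets (S \<Otimes>\<^sub>M N)" for Q
    using Int_stable_pair_measure_generator[of S N] pair_measure_closed[of S N] that
    unfolding sets_pair_measure
  proof (induct rule: sigma_sets_induct_disjoint)
    case (basic Q)
    then show ?case using rects by auto
  next
    case empty
    then show ?case by (simp add: I_def J_def)
  next
    case (compl Q)
    then have Q [measurable]: "Q \<in> sets (S \<Otimes>\<^sub>M N)" by (simp add: sets_pair_measure)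
    have sp: "space S \<times> space N = space (S \<Otimes>\<^sub>M N)" by (simp add: space_pair_measure)
    let ?C = "space (S \<Otimes>\<^sub>M N) - Q"
    have eq: "indicator (space (S \<Otimes>\<^sub>M N)) p = indicator ?C p + (indicator Q p :: ennreal)"
      if "p \<in> space (S \<Otimes>\<^sub>M N)" for p using that by (auto simp: indicator_def)
    have "I (indicator (space (S \<Otimes>\<^sub>M N))) = J (indicator (space (S \<Otimes>\<^sub>M N)))"
      using rects[of "space S" "space N"] by (simp add: space_pair_measure)
    moreover have "I (indicator (space (S \<Otimes>\<^sub>M N))) = I (indicator ?C) + I (indicator Q)"
      by (subst IJ_cong(1)[OF eq]) (auto simp: IJ_add)
    moreover have J: "J (indicator (space (S \<Otimes>\<^sub>M N))) = J (indicator ?C) + J (indicator Q)"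
      by (subst IJ_cong(2)[OF eq]) (auto simp: IJ_add)
    moreover have "J (indicator Q) < \<infinity>"
      using Jfin unfolding J by simp
    ultimately show ?case using compl unfolding sp by (auto simp: add.commute[of _ "J (indicator Q)"] ennreal_add_left_cancel)
  next
    case (union Q)
    then have Q [measurable]: "Q i \<in> sets (S \<Otimes>\<^sub>M N)" for i by (auto simp: sets_pair_measure)
    have eq: "indicator (\<Union>i. Q i) = (\<lambda>p. SUP n. \<Sum>i<n. (indicator (Q i) p :: ennreal))"
      using union(1) by (auto simp: fun_eq_iff suminf_indicator[symmetric] suminf_eq_SUP)
    have fin: "I (\<lambda>p. \<Sum>i<n. indicator (Q i) p) = J (\<lambda>p. \<Sum>i<n. indicator (Q i) p)" for n
    proof (induct n)
      case 0
      then show ?case by (simp add: I_def J_def)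
    next
      case (Suc n)
      then show ?case using union(3) by (simp add: IJ_add)
    qed
    have inc: "incseq (\<lambda>n p. \<Sum>i<n. (indicator (Q i) p :: ennreal))"
      by (auto simp: incseq_def le_fun_def intro!: sum_mono2)
    show ?case
      unfolding eq
      using SUP(1)[OF _ inc] SUP(2)[OF _ inc] by (simp add: fin)
  qed
  have "I h = J h"
    using h
  proof (induct rule: borel_measurable_induct)
    case (cong f g)
    then show ?case using IJ_cong[of f g] by simp
  next
    case (set A) then show ?case by (rule ind)
  next
    case (mult u c) then show ?case by (simp add: cmult)
  next
    case (add u v) then show ?case by (simp add: IJ_add)
  next
    case (seq U)
    have "(SUP i. U i) = (\<lambda>p. SUP i. U i p)" by (auto simp: fun_eq_iff image_comp)
    then show ?case using SUP[of U] seq by simp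
  qed
  then show ?thesis by (simp add: I_def J_def)
qed

text \<open>A Campbell-type formula. For the product of a covariate set \<open>B\<close> and a set
\<open>A\<close> of diagram points it says that
\<open>E[1\<^sub>B(Z) \<mu>(A)] = E[1\<^sub>B(Z) \<Lambda>\<^sub>Z(A)]\<close>, the defining property of the conditional expectation. The moment
assumption on the density serves to bound the expected total mass of the conditional mean
measure.\<close>

lemma nn_integral_cond_mean_measure:
  fixes Z :: "'w \<Rightarrow> 'z::topological_space"
  assumes "prob_space M" and L: "0 \<le> L" and w: "is_weight L w"
    and Z [measurable]: "Z \<in> measurable M (restrict_space borel ZZ)"
    and D [measurable]: "D \<in> measurable M (dgm_space L)"
    and cond_mean: "is_cond_mean_measure M L w ZZ Z D Lam"
    and lam [measurable]: "(\<lambda>(z, u). lam z u) \<in> borel_measurable (restrict_space borel ZZ \<Otimes>\<^sub>M borel_bar L)"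
    and lam_density: "\<And>z. z \<in> ZZ \<Longrightarrow> Lam z = density (leb_bar L) (\<lambda>u. ennreal (lam z u))"
    and fin: "(\<integral>\<^sup>+\<omega>. \<integral>\<^sup>+u. ennreal ((lam (Z \<omega>) u)\<^sup>2) \<partial>leb_bar L \<partial>M) < \<infinity>"
    and h [measurable]: "h \<in> borel_measurable (restrict_space borel ZZ \<Otimes>\<^sub>M borel_bar L)"
  shows "(\<integral>\<^sup>+\<omega>. \<integral>\<^sup>+u. h (Z \<omega>, u) \<partial>weighted_measure L w (D \<omega>) \<partial>M) =
    (\<integral>\<^sup>+\<omega>. \<integral>\<^sup>+u. ennreal (lam (Z \<omega>) u) * h (Z \<omega>, u) \<partial>leb_bar L \<partial>M)"
proof -
  interpret prob_space M by fact
  interpret leb: finite_measure "leb_bar L" by (rule finite_measure_leb_bar)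
  note sets_leb_bar [measurable_cong]
  let ?S = "restrict_space borel ZZ" and ?F = "vimage_algebra (space M) Z borel"
  have ZZ: "Z \<omega> \<in> ZZ" if "\<omega> \<in> space M" for \<omega>
    using measurable_space[OF Z that] by (simp add: space_restrict_space)
  have Zb [measurable]: "Z \<in> borel_measurable M"
    using Z by (simp add: measurable_restrict_space2_iff)
  have lamz: "(\<lambda>u. ennreal (lam (Z \<omega>) u)) \<in> borel_measurable (leb_bar L)" if "\<omega> \<in> space M" for \<omega>
    using measurable_Pair2[OF lam, of "Z \<omega>"] measurable_space[OF Z that]
    by (auto simp: measurable_cong_sets[OF sets_leb_bar refl])
  \<comment> \<open>The conditional expectation is taken given the sigma-algebra generated by \<open>Z\<close>.\<close>
  have sub: "subalgebra M ?F"
    using measurable_sets[OF Zb]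
    by (auto simp: subalgebra_def sets_vimage_algebra2)
  interpret F: finite_measure_subalgebra M ?F by standard (fact sub)
  have Fs: "(\<lambda>\<omega>. indicator B (Z \<omega>) :: ennreal) \<in> borel_measurable ?F" if "B \<in> sets ?S" for B
  proof -
    have "Z \<in> measurable ?F ?S"
      using ZZ by (auto simp: measurable_restrict_space2_iff intro: measurable_vimage_algebra1)
    then show ?thesis using that by measurable
  qed
  have wmeas: "(\<lambda>\<omega>. emeasure (weighted_measure L w (D \<omega>)) A) \<in> borel_measurable M"
    if A [measurable]: "A \<in> sets (borel_bar L)" for A
  proof -
    have "(\<lambda>\<omega>. \<integral>\<^sup>+u. indicator A u \<partial>weighted_measure L w (D \<omega>)) \<in> borel_measurable M"
      by (rule measurable_nn_integral_weighted_measure[OF L w _ D]) measurable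
    then show ?thesis using A by simp
  qed
  have "(\<integral>\<^sup>+\<omega>. \<integral>\<^sup>+u. h (Z \<omega>, u) \<partial>weighted_measure L w (D \<omega>) \<partial>M) =
      (\<integral>\<^sup>+\<omega>. \<integral>\<^sup>+u. h (Z \<omega>, u) \<partial>Lam (Z \<omega>) \<partial>M)"
  proof (rule nn_integral_kernels_eqI[OF Z _ _ _ _ _ _ h])
    show "sets (weighted_measure L w (D \<omega>)) = sets (borel_bar L)" for \<omega> by simp
    show "sets (Lam (Z \<omega>)) = sets (borel_bar L)" if "\<omega> \<in> space M" for \<omega>
      by (simp add: lam_density[OF ZZ[OF that]] sets_leb_bar)
  next
    fix f :: "'z \<times> real \<times> real \<Rightarrow> ennreal"
    assume f [measurable]: "f \<in> borel_measurable (?S \<Otimes>\<^sub>M borel_bar L)"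
    show "(\<lambda>\<omega>. \<integral>\<^sup>+u. f (Z \<omega>, u) \<partial>weighted_measure L w (D \<omega>)) \<in> borel_measurable M"
      by (rule measurable_nn_integral_weighted_measure[OF L w _ D]) measurable
    have "(\<lambda>\<omega>. \<integral>\<^sup>+u. ennreal (lam (Z \<omega>) u) * f (Z \<omega>, u) \<partial>leb_bar L) \<in> borel_measurable M"
      by (rule measurable_nn_integral_leb_bar) measurable
    also have "?this \<longleftrightarrow> (\<lambda>\<omega>. \<integral>\<^sup>+u. f (Z \<omega>, u) \<partial>Lam (Z \<omega>)) \<in> borel_measurable M"
      using ZZ measurable_space[OF Z]
      by (intro measurable_cong, subst lam_density, simp, subst nn_integral_density)
         (auto intro!: lamz measurable_Pair2[OF f] simp: measurable_cong_sets[OF sets_leb_bar refl])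
    finally show "(\<lambda>\<omega>. \<integral>\<^sup>+u. f (Z \<omega>, u) \<partial>Lam (Z \<omega>)) \<in> borel_measurable M" .
  next
    fix B and A :: "(real \<times> real) set"
    assume B: "B \<in> sets ?S" and A: "A \<in> sets (borel_bar L)"
    have AE: "AE \<omega> in M. emeasure (Lam (Z \<omega>)) A =
        nn_cond_exp M ?F (\<lambda>\<omega>. emeasure (weighted_measure L w (D \<omega>)) A) \<omega>"
      using cond_mean A unfolding is_cond_mean_measure_def by blast
    have "(\<integral>\<^sup>+\<omega>. indicator B (Z \<omega>) * emeasure (weighted_measure L w (D \<omega>)) A \<partial>M) =
        (\<integral>\<^sup>+\<omega>. indicator B (Z \<omega>) *
          nn_cond_exp M ?F (\<lambda>\<omega>. emeasure (weighted_measure L w (D \<omega>)) A) \<omega> \<partial>M)"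
      by (rule F.nn_cond_exp_intg[symmetric]) (fact Fs[OF B] wmeas[OF A])+
    also have "\<dots> = (\<integral>\<^sup>+\<omega>. indicator B (Z \<omega>) * emeasure (Lam (Z \<omega>)) A \<partial>M)"
      using AE by (intro nn_integral_cong_AE) auto
    finally show "(\<integral>\<^sup>+\<omega>. indicator B (Z \<omega>) * emeasure (weighted_measure L w (D \<omega>)) A \<partial>M) =
        (\<integral>\<^sup>+\<omega>. indicator B (Z \<omega>) * emeasure (Lam (Z \<omega>)) A \<partial>M)" .
  next
    have "(\<integral>\<^sup>+\<omega>. emeasure (Lam (Z \<omega>)) (space (borel_bar L)) \<partial>M) =
        (\<integral>\<^sup>+\<omega>. \<integral>\<^sup>+u. ennreal (lam (Z \<omega>) u) \<partial>leb_bar L \<partial>M)"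
    proof (rule nn_integral_cong)
      fix \<omega> assume \<omega>: "\<omega> \<in> space M"
      have "space (borel_bar L) \<in> sets (leb_bar L)" by (metis sets.top sets_leb_bar)
      then show "emeasure (Lam (Z \<omega>)) (space (borel_bar L)) = (\<integral>\<^sup>+u. ennreal (lam (Z \<omega>) u) \<partial>leb_bar L)"
        unfolding lam_density[OF ZZ[OF \<omega>]]
        by (subst emeasure_density[OF lamz[OF \<omega>]])
           (auto intro!: nn_integral_cong simp: space_restrict_space)
    qed
    \<comment> \<open>On a set of finite Lebesgue measure, \<open>x \<le> 1 + x\<^sup>2\<close> controls the first moment by the second.\<close>
    also have "\<dots> \<le> (\<integral>\<^sup>+\<omega>. \<integral>\<^sup>+u. 1 + ennreal ((lam (Z \<omega>) u)\<^sup>2) \<partial>leb_bar L \<partial>M)"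
    proof (intro nn_integral_mono)
      fix \<omega> u
      have "lam (Z \<omega>) u \<le> 1 + (lam (Z \<omega>) u)\<^sup>2"
        using zero_le_power2[of "lam (Z \<omega>) u - 1 / 2"]
        by (simp add: power2_eq_square algebra_simps)
      then have "ennreal (lam (Z \<omega>) u) \<le> ennreal (1 + (lam (Z \<omega>) u)\<^sup>2)" by (rule ennreal_leI)
      then show "ennreal (lam (Z \<omega>) u) \<le> 1 + ennreal ((lam (Z \<omega>) u)\<^sup>2)" by simp
    qed
    also have "\<dots> = emeasure (leb_bar L) (space (leb_bar L)) +
        (\<integral>\<^sup>+\<omega>. \<integral>\<^sup>+u. ennreal ((lam (Z \<omega>) u)\<^sup>2) \<partial>leb_bar L \<partial>M)"
    proof -
      have "(\<integral>\<^sup>+u. 1 + ennreal ((lam (Z \<omega>) u)\<^sup>2) \<partial>leb_bar L) =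
          emeasure (leb_bar L) (space (leb_bar L)) + (\<integral>\<^sup>+u. ennreal ((lam (Z \<omega>) u)\<^sup>2) \<partial>leb_bar L)"
        if "\<omega> \<in> space M" for \<omega>
      proof -
        have "(\<lambda>u. lam (Z \<omega>) u) \<in> borel_measurable (leb_bar L)"
          using measurable_Pair2[OF lam, of "Z \<omega>"] measurable_space[OF Z that]
          by (auto simp: measurable_cong_sets[OF sets_leb_bar refl])
        then show ?thesis by (subst nn_integral_add) auto
      qed
      then have "(\<integral>\<^sup>+\<omega>. \<integral>\<^sup>+u. 1 + ennreal ((lam (Z \<omega>) u)\<^sup>2) \<partial>leb_bar L \<partial>M) =
          (\<integral>\<^sup>+\<omega>. emeasure (leb_bar L) (space (leb_bar L)) +
            (\<integral>\<^sup>+u. ennreal ((lam (Z \<omega>) u)\<^sup>2) \<partial>leb_bar L) \<partial>M)"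
        by (rule nn_integral_cong)
      also have "\<dots> = emeasure (leb_bar L) (space (leb_bar L)) +
        (\<integral>\<^sup>+\<omega>. \<integral>\<^sup>+u. ennreal ((lam (Z \<omega>) u)\<^sup>2) \<partial>leb_bar L \<partial>M)"
        by (subst nn_integral_add)
           (auto intro!: measurable_nn_integral_leb_bar simp: emeasure_space_1)
      finally show ?thesis .
    qed
    also have "\<dots> < \<infinity>"
      using fin leb.emeasure_finite[of "space (leb_bar L)"] unfolding infinity_ennreal_def
      by (metis ennreal_add_eq_top top.not_eq_extremum)
    finally show "(\<integral>\<^sup>+\<omega>. emeasure (Lam (Z \<omega>)) (space (borel_bar L)) \<partial>M) < \<infinity>" .
  qed
  also have "\<dots> = (\<integral>\<^sup>+\<omega>. \<integral>\<^sup>+u. ennreal (lam (Z \<omega>) u) * h (Z \<omega>, u) \<partial>leb_bar L \<partial>M)"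
    using ZZ measurable_space[OF Z]
    by (intro nn_integral_cong, subst lam_density, simp, subst nn_integral_density)
       (auto intro!: lamz measurable_Pair2[OF h] simp: measurable_cong_sets[OF sets_leb_bar refl])
  finally show ?thesis .
qed

section \<open>The leave-one-out estimator\<close>

lemma kernel_mass_measurable [measurable]:
  assumes [measurable]: "K \<in> borel_measurable borel" "S \<in> sets borel"
  shows "kernel_mass K S h \<in> borel_measurable borel"
  unfolding kernel_mass_def set_lebesgue_integral_def scaled_kernel_def by measurable

lemma kappa_measurable [measurable (raw)]:
  assumes [measurable]: "K \<in> borel_measurable borel" "S \<in> sets borel"
    "f \<in> borel_measurable N" "g \<in> borel_measurable N"
  shows "(\<lambda>x. kappa K S h (f x) (g x)) \<in> borel_measurable N"
  unfolding kappa_def scaled_kernel_def by measurable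

lemma kappa_nonneg:
  assumes "\<And>x. 0 \<le> K x" "0 < h"
  shows "0 \<le> kappa K S h z z'"
  unfolding kappa_def kernel_mass_def scaled_kernel_def set_lebesgue_integral_def
  using assms by (auto intro!: divide_nonneg_nonneg integral_nonneg_AE)

lemma smoothed_measurable:
  assumes "0 \<le> L" "is_weight L w"
    and KU [measurable]: "KU \<in> borel_measurable borel" and KU0: "\<And>x. 0 \<le> KU x" and hU: "0 < hU"
    and D [measurable]: "D \<in> measurable N (dgm_space L)" and [measurable]: "u \<in> borel_measurable N"
  shows "(\<lambda>x. smoothed L w KU hU (D x) (u x)) \<in> borel_measurable N"
proof -
  have id: "(\<lambda>v. v) \<in> measurable (borel_bar L) borel"
    by (intro measurable_restrict_space1) simp
  note measurable_compose[OF measurable_snd id, measurable]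
  \<comment> \<open>This includes the divergent case: both sides then take the value 0.\<close>
  have eq: "smoothed L w KU hU (D x) (u x) =
      enn2real (\<integral>\<^sup>+v. ennreal (kappa KU (Omega_bar L) hU (u x) v) \<partial>weighted_measure L w (D x))" for x
    unfolding smoothed_def
    by (rule integral_eq_nn_integral)
       (auto simp: kappa_nonneg[OF KU0 hU] measurable_cong_sets[OF sets_weighted_measure refl]
         intro!: measurable_restrict_space1)
  have "(\<lambda>x. \<integral>\<^sup>+v. ennreal (kappa KU (Omega_bar L) hU (u x) v) \<partial>weighted_measure L w (D x)) \<in> borel_measurable N"
    by (rule measurable_nn_integral_weighted_measure[OF assms(1,2) _ D]) measurable
  then show ?thesis unfolding eq by measurable
qed

lemma loo_estimator_nonneg:
  assumes "\<And>x. 0 \<le> KZ x" "0 < hZ" "\<And>x. 0 \<le> KU x" "0 < hU"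
  shows "0 \<le> loo_estimator L w ZZ KZ KU hZ hU n zs ds i z u"
proof -
  have "0 \<le> smoothed L w KU hU D u" for D
    unfolding smoothed_def by (intro Bochner_Integration.integral_nonneg kappa_nonneg assms)
  then show ?thesis
    unfolding loo_estimator_def Let_def
    by (auto intro!: divide_nonneg_nonneg sum_nonneg mult_nonneg_nonneg kappa_nonneg assms)
qed

lemma loo_estimator_measurable:
  assumes L: "0 \<le> L" and w: "is_weight L w" and ZZ [measurable]: "ZZ \<in> sets borel"
    and [measurable]: "KZ \<in> borel_measurable borel"
    and KU: "KU \<in> borel_measurable borel" "\<And>x. 0 \<le> KU x" "0 < hU"
    and [measurable]: "\<And>j. j \<in> {1..n} - {i} \<Longrightarrow> zs j \<in> borel_measurable N"
    and ds: "\<And>j. j \<in> {1..n} - {i} \<Longrightarrow> ds j \<in> measurable N (dgm_space L)"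
    and [measurable]: "z \<in> borel_measurable N" "u \<in> borel_measurable N"
  shows "(\<lambda>x. loo_estimator L w ZZ KZ KU hZ hU n (\<lambda>j. zs j x) (\<lambda>j. ds j x) i (z x) (u x)) \<in> borel_measurable N"
proof -
  have [measurable]: "(\<lambda>x. smoothed L w KU hU (ds j x) (u x)) \<in> borel_measurable N"
    if "j \<in> {1..n} - {i}" for j
    by (intro smoothed_measurable[OF L w KU] ds that) measurable
  show ?thesis unfolding loo_estimator_def Let_def by measurable
qed

text \<open>This is what makes the estimator deterministic once the observations other than the left-out
one are frozen.\<close>

lemma loo_estimator_cong:
  assumes "\<And>j. j \<in> {1..n} - {i} \<Longrightarrow> zs j = zs' j" "\<And>j. j \<in> {1..n} - {i} \<Longrightarrow> ds j = ds' j"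
  shows "loo_estimator L w ZZ KZ KU hZ hU n zs ds i z u = loo_estimator L w ZZ KZ KU hZ hU n zs' ds' i z u"
proof -
  have "(\<Sum>j\<in>{1..n} - {i}. kappa KZ ZZ hZ z (zs j)) = (\<Sum>j\<in>{1..n} - {i}. kappa KZ ZZ hZ z (zs' j))"
    "(\<Sum>j\<in>{1..n} - {i}. kappa KZ ZZ hZ z (zs j) * smoothed L w KU hU (ds j) u) =
     (\<Sum>j\<in>{1..n} - {i}. kappa KZ ZZ hZ z (zs' j) * smoothed L w KU hU (ds' j) u)"
    using assms by (auto intro!: sum.cong)
  then show ?thesis unfolding loo_estimator_def by (simp only: Let_def)
qed

lemma loo_estimator_permute:
  assumes p: "p permutes {1..n}"
  shows "loo_estimator L w ZZ KZ KU hZ hU n zs ds (p i) z u =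
    loo_estimator L w ZZ KZ KU hZ hU n (\<lambda>j. zs (p j)) (\<lambda>j. ds (p j)) i z u"
proof -
  have "bij_betw p ({1..n} - {i}) (p ` ({1..n} - {i}))"
    by (rule inj_on_imp_bij_betw) (rule inj_on_subset[OF permutes_inj[OF p] subset_UNIV])
  also have "p ` ({1..n} - {i}) = {1..n} - {p i}"
    using permutes_image[OF p] permutes_inj[OF p] by (simp add: image_set_diff)
  finally have *: "(\<Sum>j\<in>{1..n} - {p i}. g j) = (\<Sum>j\<in>{1..n} - {i}. g (p j))" for g :: "nat \<Rightarrow> real"
    by (rule sum.reindex_bij_betw[symmetric])
  show ?thesis unfolding loo_estimator_def * ..
qed

lemma loo_estimator_sample_measurable:
  assumes L: "0 \<le> L" and w: "is_weight L w" and ZZ: "ZZ \<in> sets borel"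
    and KZ: "KZ \<in> borel_measurable borel"
    and KU: "KU \<in> borel_measurable borel" "\<And>x. 0 \<le> KU x" "0 < hU"
    and i: "i \<in> {1..n}"
  shows "(\<lambda>(xs, u). loo_estimator L w ZZ KZ KU hZ hU n (\<lambda>j. fst (xs j)) (\<lambda>j. snd (xs j)) i (fst (xs i)) u)
    \<in> borel_measurable (Pi\<^sub>M {1..n} (\<lambda>_. restrict_space borel ZZ \<Otimes>\<^sub>M dgm_space L) \<Otimes>\<^sub>M borel_bar L)"
proof -
  let ?S = "restrict_space borel ZZ \<Otimes>\<^sub>M dgm_space L"
  let ?P = "Pi\<^sub>M {1..n} (\<lambda>_. ?S) \<Otimes>\<^sub>M borel_bar L"
  have comp: "(\<lambda>p. fst p j) \<in> measurable ?P ?S" if "j \<in> {1..n}" for j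
    by (rule measurable_compose[OF measurable_fst measurable_component_singleton[OF that]])
  have z: "(\<lambda>p. fst (fst p j)) \<in> borel_measurable ?P" if "j \<in> {1..n}" for j
    using measurable_compose[OF comp[OF that] measurable_fst] by (simp add: measurable_restrict_space2_iff)
  have d: "(\<lambda>p. snd (fst p j)) \<in> measurable ?P (dgm_space L)" if "j \<in> {1..n}" for j
    by (rule measurable_compose[OF comp[OF that] measurable_snd])
  have u: "snd \<in> borel_measurable ?P"
    using measurable_snd[of "Pi\<^sub>M {1..n} (\<lambda>_. ?S)" "borel_bar L"] by (simp add: measurable_restrict_space2_iff)
  show ?thesis
    unfolding case_prod_beta
    by (intro loo_estimator_measurable[OF L w ZZ KZ KU] z d u i) auto
qed

section \<open>Exchangeability and freezing of independent observations\<close>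

lemma (in prob_space) distr_indep_vars_eq_PiM:
  assumes "indep_vars (\<lambda>_. S) X I" "I \<noteq> {}"
  shows "distr M (Pi\<^sub>M I (\<lambda>_. S)) (\<lambda>\<omega>. \<lambda>i\<in>I. X i \<omega>) = Pi\<^sub>M I (\<lambda>i. distr M S (X i))"
  using assms indep_vars_iff_distr_eq_PiM'[where I = I and M' = "\<lambda>_. S" and X = X] by (auto simp: indep_vars_def)

text \<open>The joint law is a power of a single probability measure, and product measures are invariant
under a relabelling of identical factors.\<close>

lemma (in prob_space) nn_integral_iid_permute:
  assumes indep: "indep_vars (\<lambda>_. S) X I"
    and ident: "\<And>i. i \<in> I \<Longrightarrow> distr M S (X i) = \<nu>"
    and p: "p permutes I" and I: "I \<noteq> {}"
    and f [measurable]: "f \<in> borel_measurable (Pi\<^sub>M I (\<lambda>_. S))"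
  shows "(\<integral>\<^sup>+\<omega>. f (\<lambda>i\<in>I. X (p i) \<omega>) \<partial>M) = (\<integral>\<^sup>+\<omega>. f (\<lambda>i\<in>I. X i \<omega>) \<partial>M)"
proof -
  have rv [measurable]: "X i \<in> measurable M S" if "i \<in> I" for i
    using indep that by (auto simp: indep_vars_def)
  obtain i0 where i0: "i0 \<in> I" using I by blast
  have \<nu>: "prob_space \<nu>" "sets \<nu> = sets S"
    unfolding ident[OF i0, symmetric] using prob_space_distr[OF rv[OF i0]] by auto
  have sets: "sets (Pi\<^sub>M I (\<lambda>_. \<nu>)) = sets (Pi\<^sub>M I (\<lambda>_. S))"
    using \<nu> by (intro sets_PiM_cong) auto
  have law: "distr M (Pi\<^sub>M I (\<lambda>_. S)) (\<lambda>\<omega>. \<lambda>i\<in>I. X i \<omega>) = Pi\<^sub>M I (\<lambda>_. \<nu>)"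
    unfolding distr_indep_vars_eq_PiM[OF indep I] by (intro PiM_cong ident refl)
  have inI: "p i \<in> I" if "i \<in> I" for i using permutes_in_image[OF p] that by simp
  have [measurable]: "(\<lambda>x. \<lambda>i\<in>I. x (p i)) \<in> measurable (Pi\<^sub>M I (\<lambda>_. S)) (Pi\<^sub>M I (\<lambda>_. S))"
    by (intro measurable_restrict measurable_component_singleton inI)
  have reindex: "distr (Pi\<^sub>M I (\<lambda>_. \<nu>)) (Pi\<^sub>M I (\<lambda>_. \<nu>)) (\<lambda>x. \<lambda>i\<in>I. x (p i)) = Pi\<^sub>M I (\<lambda>_. \<nu>)"
    using inI \<nu> by (intro distr_PiM_reindex) (auto intro: inj_on_subset[OF permutes_inj[OF p]])
  have Xm [measurable]: "(\<lambda>\<omega>. \<lambda>i\<in>I. X i \<omega>) \<in> measurable M (Pi\<^sub>M I (\<lambda>_. S))"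
    by (intro measurable_restrict rv)
  have "(\<integral>\<^sup>+\<omega>. f (\<lambda>i\<in>I. X (p i) \<omega>) \<partial>M) = (\<integral>\<^sup>+\<omega>. f (\<lambda>i\<in>I. (\<lambda>i\<in>I. X i \<omega>) (p i)) \<partial>M)"
    by (intro nn_integral_cong arg_cong[of _ _ f]) (auto simp: restrict_def inI)
  also have "\<dots> = (\<integral>\<^sup>+x. f (\<lambda>i\<in>I. x (p i)) \<partial>Pi\<^sub>M I (\<lambda>_. \<nu>))"
    unfolding law[symmetric] by (subst nn_integral_distr) measurable
  also have "\<dots> = (\<integral>\<^sup>+x. f x \<partial>Pi\<^sub>M I (\<lambda>_. \<nu>))"
    by (subst (2) reindex[symmetric], subst nn_integral_distr)
       (auto simp: measurable_cong_sets[OF sets sets] measurable_cong_sets[OF sets refl]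
          measurable_cong_sets[OF refl sets] intro: measurable_compose)
  also have "\<dots> = (\<integral>\<^sup>+\<omega>. f (\<lambda>i\<in>I. X i \<omega>) \<partial>M)"
    unfolding law[symmetric] by (subst nn_integral_distr) measurable
  finally show ?thesis .
qed

text \<open>Under a product law one may integrate out the component \<open>i\<close> first. Two functionals
of an independent family hence have equal expectation as soon as they do when the remaining
components are frozen.\<close>

lemma (in prob_space) nn_integral_indep_vars_cong_component:
  assumes indep: "indep_vars (\<lambda>_. S) X I" and I: "finite I" "i \<in> I"
    and f: "f \<in> borel_measurable (Pi\<^sub>M I (\<lambda>_. S))" and g: "g \<in> borel_measurable (Pi\<^sub>M I (\<lambda>_. S))"
    and eq: "\<And>x. x \<in> space (Pi\<^sub>M (I - {i}) (\<lambda>_. S)) \<Longrightarrow>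
      (\<integral>\<^sup>+\<omega>. f (x(i := X i \<omega>)) \<partial>M) = (\<integral>\<^sup>+\<omega>. g (x(i := X i \<omega>)) \<partial>M)"
  shows "(\<integral>\<^sup>+\<omega>. f (\<lambda>i\<in>I. X i \<omega>) \<partial>M) = (\<integral>\<^sup>+\<omega>. g (\<lambda>i\<in>I. X i \<omega>) \<partial>M)"
proof -
  have rv: "X i \<in> measurable M S" if "i \<in> I" for i
    using indep that by (auto simp: indep_vars_def)
  have ne: "I \<noteq> {}" using I by blast
  \<comment> \<open>Outside \<open>I\<close> the law of \<open>X i\<close> is a filler: the product measure locale wants a measure for every index.\<close>
  define \<nu> where "\<nu> j = distr M S (X (if j \<in> I then j else i))" for j
  have pr: "prob_space (\<nu> j)" for j
    unfolding \<nu>_def using I by (intro prob_space_distr rv) auto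
  interpret product_sigma_finite \<nu>
    unfolding product_sigma_finite_def by (intro allI prob_space_imp_sigma_finite pr)
  have law: "distr M (Pi\<^sub>M I (\<lambda>_. S)) (\<lambda>\<omega>. \<lambda>i\<in>I. X i \<omega>) = Pi\<^sub>M I \<nu>"
    unfolding distr_indep_vars_eq_PiM[OF indep ne] by (intro PiM_cong) (auto simp: \<nu>_def)
  have sets: "sets (Pi\<^sub>M J \<nu>) = sets (Pi\<^sub>M J (\<lambda>_. S))" for J
    by (intro sets_PiM_cong) (auto simp: \<nu>_def)
  have ins: "insert i (I - {i}) = I" using I by blast
  have expand: "(\<integral>\<^sup>+\<omega>. h (\<lambda>i\<in>I. X i \<omega>) \<partial>M) =
      (\<integral>\<^sup>+x. \<integral>\<^sup>+\<omega>. h (x(i := X i \<omega>)) \<partial>M \<partial>Pi\<^sub>M (I - {i}) \<nu>)"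
    if h [measurable]: "h \<in> borel_measurable (Pi\<^sub>M I (\<lambda>_. S))" for h
  proof -
    have Xm: "(\<lambda>\<omega>. \<lambda>i\<in>I. X i \<omega>) \<in> measurable M (Pi\<^sub>M I (\<lambda>_. S))"
      by (intro measurable_restrict rv)
    have "(\<integral>\<^sup>+\<omega>. h (\<lambda>i\<in>I. X i \<omega>) \<partial>M) = (\<integral>\<^sup>+x. h x \<partial>Pi\<^sub>M (insert i (I - {i})) \<nu>)"
      unfolding ins law[symmetric] by (subst nn_integral_distr[OF Xm]) auto
    also have "\<dots> = (\<integral>\<^sup>+x. \<integral>\<^sup>+y. h (x(i := y)) \<partial>\<nu> i \<partial>Pi\<^sub>M (I - {i}) \<nu>)"
    proof (rule product_nn_integral_insert)
      show "h \<in> borel_measurable (Pi\<^sub>M (insert i (I - {i})) \<nu>)"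
        unfolding ins using h measurable_cong_sets[OF sets refl] by blast
    qed (use I in auto)
    also have "\<dots> = (\<integral>\<^sup>+x. \<integral>\<^sup>+\<omega>. h (x(i := X i \<omega>)) \<partial>M \<partial>Pi\<^sub>M (I - {i}) \<nu>)"
    proof (rule nn_integral_cong)
      fix x assume "x \<in> space (Pi\<^sub>M (I - {i}) \<nu>)"
      then have x: "x \<in> space (Pi\<^sub>M (I - {i}) (\<lambda>_. S))"
        by (simp add: sets_eq_imp_space_eq[OF sets])
      have "(\<lambda>y. x(i := y)) \<in> measurable S (Pi\<^sub>M I (\<lambda>_. S))"
        by (rule measurable_fun_upd[of I "I - {i}" i, OF _ measurable_const[OF x]]) (use I in auto)
      then have "(\<lambda>y. h (x(i := y))) \<in> borel_measurable S" by (rule measurable_compose[OF _ h])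
      then show "(\<integral>\<^sup>+y. h (x(i := y)) \<partial>\<nu> i) = (\<integral>\<^sup>+\<omega>. h (x(i := X i \<omega>)) \<partial>M)"
        using I unfolding \<nu>_def by (simp add: nn_integral_distr[OF rv])
    qed
    finally show ?thesis .
  qed
  show ?thesis
    unfolding expand[OF f] expand[OF g]
    by (intro nn_integral_cong eq) (simp add: sets_eq_imp_space_eq[OF sets])
qed

section \<open>The cross term\<close>

text \<open>With all observations but the \<open>i\<close>-th frozen, the estimator is a fixed function of the
\<open>i\<close>-th covariate and of the point \<open>u\<close>, so the Campbell-type formula applies to the \<open>i\<close>-th
observation alone. Independence then allows averaging over the frozen ones.\<close>

lemma nn_integral_loo_estimator_cond_mean:
  fixes Z :: "nat \<Rightarrow> 'w \<Rightarrow> 'z::euclidean_space" and hZ :: real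
  assumes "prob_space M" and L: "0 \<le> L" and w: "is_weight L w" and ZZ: "ZZ \<in> sets borel"
    and indep: "prob_space.indep_vars M (\<lambda>_. restrict_space borel ZZ \<Otimes>\<^sub>M dgm_space L)
           (\<lambda>i \<omega>. (Z i \<omega>, D i \<omega>)) {1..n}"
    and KZ: "KZ \<in> borel_measurable borel"
    and KU: "KU \<in> borel_measurable borel" "\<And>x. 0 \<le> KU x" "0 < hU"
    and i: "i \<in> {1..n}"
    and cond_mean: "is_cond_mean_measure M L w ZZ (Z i) (D i) Lam"
    and lam: "(\<lambda>(z, u). lam z u) \<in> borel_measurable (restrict_space borel ZZ \<Otimes>\<^sub>M borel_bar L)"
    and lam_density: "\<And>z. z \<in> ZZ \<Longrightarrow> Lam z = density (leb_bar L) (\<lambda>u. ennreal (lam z u))"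
    and fin: "(\<integral>\<^sup>+\<omega>. \<integral>\<^sup>+u. ennreal ((lam (Z i \<omega>) u)\<^sup>2) \<partial>leb_bar L \<partial>M) < \<infinity>"
  defines "est \<equiv> \<lambda>\<omega>. loo_estimator L w ZZ KZ KU hZ hU n (\<lambda>j. Z j \<omega>) (\<lambda>j. D j \<omega>) i (Z i \<omega>)"
  shows "(\<integral>\<^sup>+\<omega>. \<integral>\<^sup>+u. ennreal (est \<omega> u) \<partial>weighted_measure L w (D i \<omega>) \<partial>M) =
    (\<integral>\<^sup>+\<omega>. \<integral>\<^sup>+u. ennreal (lam (Z i \<omega>) u) * ennreal (est \<omega> u) \<partial>leb_bar L \<partial>M)"
proof -
  interpret prob_space M by fact
  let ?S = "restrict_space borel ZZ \<Otimes>\<^sub>M dgm_space L" and ?I = "{1..n}"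
  let ?P = "Pi\<^sub>M ?I (\<lambda>_. ?S)"
  define X where "X j \<omega> = (Z j \<omega>, D j \<omega>)" for j \<omega>
  have indepX: "indep_vars (\<lambda>_. ?S) X ?I" using indep by (simp add: X_def[abs_def])
  have Xi: "X i \<in> measurable M ?S" using indepX i by (auto simp: indep_vars_def)
  have Zi: "Z i \<in> measurable M (restrict_space borel ZZ)" and Di: "D i \<in> measurable M (dgm_space L)"
    using measurable_compose[OF Xi measurable_fst] measurable_compose[OF Xi measurable_snd]
    by (simp_all add: X_def[abs_def])
  define e where "e xs = loo_estimator L w ZZ KZ KU hZ hU n (\<lambda>j. fst (xs j)) (\<lambda>j. snd (xs j)) i"
    for xs :: "nat \<Rightarrow> 'z \<times> diagram"
  have e_meas [measurable]: "(\<lambda>p. e (fst p) (fst (fst p i)) (snd p)) \<in> borel_measurable (?P \<Otimes>\<^sub>M borel_bar L)"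
    using loo_estimator_sample_measurable[OF L w ZZ KZ KU i] unfolding e_def case_prod_beta .
  have [measurable]: "(\<lambda>xs. xs i) \<in> measurable ?P ?S"
    by (rule measurable_component_singleton[OF i])
  have est: "est \<omega> u = e (\<lambda>j\<in>?I. X j \<omega>) (Z i \<omega>) u" for \<omega> u
    unfolding est_def e_def by (rule loo_estimator_cong) (auto simp: X_def)
  define f where "f xs = (\<integral>\<^sup>+u. ennreal (e xs (fst (xs i)) u) \<partial>weighted_measure L w (snd (xs i)))" for xs
  define g where "g xs = (\<integral>\<^sup>+u. ennreal (lam (fst (xs i)) u) * ennreal (e xs (fst (xs i)) u) \<partial>leb_bar L)" for xs
  have f: "f \<in> borel_measurable ?P"
    unfolding f_def
  proof (rule measurable_nn_integral_weighted_measure[OF L w])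
    show "(\<lambda>(xs, u). ennreal (e xs (fst (xs i)) u)) \<in> borel_measurable (?P \<Otimes>\<^sub>M borel_bar L)"
      unfolding case_prod_beta by (rule measurable_compose[OF e_meas measurable_ennreal])
    show "(\<lambda>xs. snd (xs i)) \<in> measurable ?P (dgm_space L)"
      by (rule measurable_compose[OF measurable_component_singleton[OF i] measurable_snd])
  qed
  have g: "g \<in> borel_measurable ?P"
  proof -
    have "(\<lambda>p. lam (fst (fst p i)) (snd p)) \<in> borel_measurable (?P \<Otimes>\<^sub>M borel_bar L)"
      by (rule measurable_compose[OF _ lam, of "\<lambda>p. (fst (fst p i), snd p)", simplified]) measurable
    then have "(\<lambda>(xs, u). ennreal (lam (fst (xs i)) u) * ennreal (e xs (fst (xs i)) u))
        \<in> borel_measurable (?P \<Otimes>\<^sub>M borel_bar L)"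
      unfolding case_prod_beta by measurable
    then show ?thesis unfolding g_def by (rule measurable_nn_integral_leb_bar)
  qed
  have "(\<integral>\<^sup>+\<omega>. f (\<lambda>j\<in>?I. X j \<omega>) \<partial>M) = (\<integral>\<^sup>+\<omega>. g (\<lambda>j\<in>?I. X j \<omega>) \<partial>M)"
  proof (rule nn_integral_indep_vars_cong_component[OF indepX _ i f g])
    fix x assume x: "x \<in> space (Pi\<^sub>M (?I - {i}) (\<lambda>_. ?S))"
    have xj: "fst (x j) \<in> ZZ" "snd (x j) \<in> space (dgm_space L)" if "j \<in> ?I - {i}" for j
    proof -
      have "x j \<in> space ?S" using x that by (auto simp only: space_PiM PiE_iff)
      then show "fst (x j) \<in> ZZ" "snd (x j) \<in> space (dgm_space L)"
        by (auto simp: space_pair_measure space_restrict_space)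
    qed
    have upd: "e (x(i := y)) = e x" for y
      unfolding e_def by (intro ext loo_estimator_cong) auto
    have z: "fst \<in> borel_measurable (restrict_space borel ZZ \<Otimes>\<^sub>M borel_bar L)"
      using measurable_fst[of "restrict_space borel ZZ" "borel_bar L"] by (simp add: measurable_restrict_space2_iff)
    have u: "snd \<in> borel_measurable (restrict_space borel ZZ \<Otimes>\<^sub>M borel_bar L)"
      using measurable_snd[of "restrict_space borel ZZ" "borel_bar L"] by (simp add: measurable_restrict_space2_iff)
    have "(\<lambda>p. ennreal (e x (fst p) (snd p))) \<in> borel_measurable (restrict_space borel ZZ \<Otimes>\<^sub>M borel_bar L)"
      unfolding e_def
      by (intro measurable_compose[OF _ measurable_ennreal] loo_estimator_measurable[OF L w ZZ KZ KU] z u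
          measurable_const xj) auto
    from nn_integral_cond_mean_measure[OF \<open>prob_space M\<close> L w Zi Di cond_mean lam lam_density fin this]
    show "(\<integral>\<^sup>+\<omega>. f (x(i := X i \<omega>)) \<partial>M) = (\<integral>\<^sup>+\<omega>. g (x(i := X i \<omega>)) \<partial>M)"
      unfolding f_def g_def upd by (simp add: X_def)
  qed simp
  then show ?thesis using i unfolding est f_def g_def by (simp add: X_def)
qed

section \<open>From nonnegative integrals to real-valued ones\<close>

lemma integral_enn2real:
  assumes [measurable]: "f \<in> borel_measurable M" and fin: "(\<integral>\<^sup>+x. f x \<partial>M) < \<infinity>"
  shows "integrable M (\<lambda>x. enn2real (f x))"
    and "(\<integral>x. enn2real (f x) \<partial>M) = enn2real (\<integral>\<^sup>+x. f x \<partial>M)"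
proof -
  have "AE x in M. f x \<noteq> \<infinity>" using fin by (intro nn_integral_PInf_AE) auto
  then have eq: "(\<integral>\<^sup>+x. ennreal (enn2real (f x)) \<partial>M) = (\<integral>\<^sup>+x. f x \<partial>M)"
    by (intro nn_integral_cong_AE) (auto simp: top.not_eq_extremum)
  show "integrable M (\<lambda>x. enn2real (f x))" using fin by (intro integrableI_nonneg) (auto simp: eq)
  show "(\<integral>x. enn2real (f x) \<partial>M) = enn2real (\<integral>\<^sup>+x. f x \<partial>M)"
    by (subst integral_eq_nn_integral) (auto simp: eq)
qed

lemma mult_le_sum_power2: "ennreal a * ennreal b \<le> ennreal (b\<^sup>2) + ennreal (a\<^sup>2)"
proof (cases "0 \<le> a \<and> 0 \<le> b")
  case True
  have "a * b \<le> b\<^sup>2 + a\<^sup>2"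
    using sum_squares_bound[of a b] True mult_nonneg_nonneg[of a b] by linarith
  then show ?thesis using True by (simp flip: ennreal_mult ennreal_plus add: ennreal_leI)
next
  case False
  then have "ennreal a * ennreal b = 0" by (auto simp: ennreal_neg)
  then show ?thesis by (simp only: zero_le)
qed

text \<open>The integrals on the right are taken in the extended nonnegative reals, where their
measurability and expectations are available without integrability of the individual sections.\<close>

lemma integral_power2_diff:
  fixes f g :: "'a \<Rightarrow> real"
  assumes [measurable]: "f \<in> borel_measurable N" "g \<in> borel_measurable N"
    and nonneg: "\<And>x. x \<in> space N \<Longrightarrow> 0 \<le> f x" "\<And>x. x \<in> space N \<Longrightarrow> 0 \<le> g x"
    and fin: "(\<integral>\<^sup>+x. ennreal ((f x)\<^sup>2) \<partial>N) < \<infinity>" "(\<integral>\<^sup>+x. ennreal ((g x)\<^sup>2) \<partial>N) < \<infinity>"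
  shows "(\<integral>x. (f x - g x)\<^sup>2 \<partial>N) = enn2real (\<integral>\<^sup>+x. ennreal ((f x)\<^sup>2) \<partial>N)
    - 2 * enn2real (\<integral>\<^sup>+x. ennreal (g x) * ennreal (f x) \<partial>N) + enn2real (\<integral>\<^sup>+x. ennreal ((g x)\<^sup>2) \<partial>N)"
proof -
  have "(\<integral>\<^sup>+x. ennreal (g x) * ennreal (f x) \<partial>N) \<le>
      (\<integral>\<^sup>+x. ennreal ((f x)\<^sup>2) + ennreal ((g x)\<^sup>2) \<partial>N)"
    by (intro nn_integral_mono mult_le_sum_power2)
  also have "\<dots> < \<infinity>" using fin by (subst nn_integral_add) auto
  finally have fing: "(\<integral>\<^sup>+x. ennreal (g x) * ennreal (f x) \<partial>N) < \<infinity>" .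
  have I: "integrable N (\<lambda>x. (f x)\<^sup>2)" "integrable N (\<lambda>x. (g x)\<^sup>2)"
    "(\<integral>x. (f x)\<^sup>2 \<partial>N) = enn2real (\<integral>\<^sup>+x. ennreal ((f x)\<^sup>2) \<partial>N)"
    "(\<integral>x. (g x)\<^sup>2 \<partial>N) = enn2real (\<integral>\<^sup>+x. ennreal ((g x)\<^sup>2) \<partial>N)"
    using integral_enn2real[OF _ fin(1)] integral_enn2real[OF _ fin(2)] by auto
  have gf: "enn2real (ennreal (g x) * ennreal (f x)) = g x * f x" if "x \<in> space N" for x
    using nonneg[OF that] by (simp flip: ennreal_mult)
  have J: "integrable N (\<lambda>x. g x * f x)"
    "(\<integral>x. g x * f x \<partial>N) = enn2real (\<integral>\<^sup>+x. ennreal (g x) * ennreal (f x) \<partial>N)"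
    using integral_enn2real[OF _ fing]
    by (simp_all add: gf cong: Bochner_Integration.integrable_cong Bochner_Integration.integral_cong)
  have "(\<lambda>x. (f x - g x)\<^sup>2) = (\<lambda>x. (f x)\<^sup>2 - 2 * (g x * f x) + (g x)\<^sup>2)"
    by (auto simp: power2_eq_square algebra_simps)
  then show ?thesis using I J by simp
qed

section \<open>Expectation of the cross-validation criterion\<close>

theorem proposition5:
  fixes M :: "'w measure" and L hZ hU :: real and n :: nat
    and ZZ :: "(real ^ 'd) set"
    and Z :: "nat \<Rightarrow> 'w \<Rightarrow> real ^ 'd" and D :: "nat \<Rightarrow> 'w \<Rightarrow> diagram"
    and w :: "real \<times> real \<Rightarrow> real"
    and KZ :: "real ^ 'd \<Rightarrow> real" and KU :: "real \<times> real \<Rightarrow> real"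
    and Lam :: "real ^ 'd \<Rightarrow> (real \<times> real) measure"
    and lam :: "real ^ 'd \<Rightarrow> real \<times> real \<Rightarrow> real"
  assumes "prob_space M" and "L > 0" and "n \<ge> 2"
    and "ZZ \<in> sets borel"
    and "is_weight L w"
    and indep: "prob_space.indep_vars M (\<lambda>_. restrict_space borel ZZ \<Otimes>\<^sub>M dgm_space L)
           (\<lambda>i \<omega>. (Z i \<omega>, D i \<omega>)) {1..n}"
    and ident: "\<And>i. i \<in> {1..n} \<Longrightarrow>
           distr M (restrict_space borel ZZ \<Otimes>\<^sub>M dgm_space L) (\<lambda>\<omega>. (Z i \<omega>, D i \<omega>)) =
           distr M (restrict_space borel ZZ \<Otimes>\<^sub>M dgm_space L) (\<lambda>\<omega>. (Z 1 \<omega>, D 1 \<omega>))"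
    and "KZ \<in> borel_measurable borel" and "\<And>x. 0 \<le> KZ x"
    and "KU \<in> borel_measurable borel" and "\<And>x. 0 \<le> KU x"
    and "hZ > 0" and "hU > 0"
    and "kernel_mass_ok KZ ZZ hZ" and "kernel_mass_ok KU (Omega_bar L) hU"
    and cond_mean: "\<And>i. i \<in> {1..n} \<Longrightarrow> is_cond_mean_measure M L w ZZ (Z i) (D i) Lam"
    and lam_meas: "(\<lambda>(z, u). lam z u) \<in> borel_measurable (restrict_space borel ZZ \<Otimes>\<^sub>M borel_bar L)"
    and lam_nonneg: "\<And>z u. z \<in> ZZ \<Longrightarrow> u \<in> Omega_bar L \<Longrightarrow> 0 \<le> lam z u"
    and lam_density: "\<And>z. z \<in> ZZ \<Longrightarrow> Lam z = density (leb_bar L) (\<lambda>u. ennreal (lam z u))"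
    and "(\<integral>\<^sup>+\<omega>. (\<integral>\<^sup>+u. ennreal ((lam (Z 1 \<omega>) u)\<^sup>2) \<partial>leb_bar L) \<partial>M) < \<infinity>"
    and "(\<integral>\<^sup>+\<omega>. (\<integral>\<^sup>+u. ennreal ((loo_estimator L w ZZ KZ KU hZ hU n
             (\<lambda>j. Z j \<omega>) (\<lambda>j. D j \<omega>) 1 (Z 1 \<omega>) u)\<^sup>2) \<partial>leb_bar L) \<partial>M) < \<infinity>"
  shows "integrable M (\<lambda>\<omega>. CV L w ZZ KZ KU hZ hU n (\<lambda>j. Z j \<omega>) (\<lambda>j. D j \<omega>)) \<and>
         (\<integral>\<omega>. CV L w ZZ KZ KU hZ hU n (\<lambda>j. Z j \<omega>) (\<lambda>j. D j \<omega>) \<partial>M)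
           = risk M L w ZZ KZ KU hZ hU n Z D lam - C0 M L Z lam"
proof -
  interpret prob_space M by fact
  let ?S = "restrict_space borel ZZ \<Otimes>\<^sub>M dgm_space L" and ?I = "{1..n}"
  let ?P = "Pi\<^sub>M ?I (\<lambda>_. ?S)"
  have L: "0 \<le> L" and one: "1 \<in> ?I" using assms(2,3) by auto
  note w = assms(5) and ZZ = assms(4) and KZ = assms(8) and KU = assms(10,11,13)
    and lam_fin = assms(20) and est_fin = assms(21)
  define X where "X j \<omega> = (Z j \<omega>, D j \<omega>)" for j \<omega>
  have indepX: "indep_vars (\<lambda>_. ?S) X ?I" using indep by (simp add: X_def[abs_def])
  have X_meas [measurable]: "X i \<in> measurable M ?S" if "i \<in> ?I" for i
    using indepX that by (auto simp: indep_vars_def)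
  have Z_meas [measurable]: "Z i \<in> measurable M (restrict_space borel ZZ)"
    and D_meas [measurable]: "D i \<in> measurable M (dgm_space L)" if "i \<in> ?I" for i
    using measurable_compose[OF X_meas[OF that] measurable_fst]
      measurable_compose[OF X_meas[OF that] measurable_snd]
    by (simp_all add: X_def[abs_def])
  have Z_in: "Z i \<omega> \<in> ZZ" if "i \<in> ?I" "\<omega> \<in> space M" for i \<omega>
    using measurable_space[OF Z_meas[OF that(1)] that(2)] by (simp add: space_restrict_space)

  define est where "est i \<omega> = loo_estimator L w ZZ KZ KU hZ hU n (\<lambda>j. Z j \<omega>) (\<lambda>j. D j \<omega>) i (Z i \<omega>)" for i \<omega>
  have est_nonneg: "0 \<le> est i \<omega> u" for i \<omega> u
    unfolding est_def using assms(9,11,12,13) by (intro loo_estimator_nonneg)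
  \<comment> \<open>The estimator without observation 1, as a function of the whole sample. The estimator without
    observation \<open>i\<close> is the same function of the sample with the observations 1 and \<open>i\<close> exchanged.\<close>
  define e where "e xs = loo_estimator L w ZZ KZ KU hZ hU n (\<lambda>j. fst (xs j)) (\<lambda>j. snd (xs j)) 1 (fst (xs 1))"
    for xs :: "nat \<Rightarrow> (real ^ 'd) \<times> diagram"
  have e_meas [measurable]: "(\<lambda>p. e (fst p) (snd p)) \<in> borel_measurable (?P \<Otimes>\<^sub>M borel_bar L)"
    using loo_estimator_sample_measurable[OF L w ZZ KZ KU one] unfolding e_def case_prod_beta .
  have Xv [measurable]: "(\<lambda>\<omega>. \<lambda>j\<in>?I. X (p j) \<omega>) \<in> measurable M ?P" if "p permutes ?I" for p
    using permutes_in_image[OF that] by (intro measurable_restrict X_meas) blast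
  define \<tau> :: "nat \<Rightarrow> nat \<Rightarrow> nat" where "\<tau> i = Transposition.transpose 1 i" for i
  have \<tau>_one: "\<tau> i 1 = i" and \<tau>_id: "\<tau> 1 j = j" for i j
    by (simp_all add: \<tau>_def)
  have perm: "\<tau> i permutes ?I" if "i \<in> ?I" for i
    unfolding \<tau>_def by (rule permutes_swap_id[OF one that])
  have est_e: "est i \<omega> = e (\<lambda>j\<in>?I. X (\<tau> i j) \<omega>)" if i: "i \<in> ?I" for i \<omega>
  proof
    fix u
    have "est i \<omega> u = loo_estimator L w ZZ KZ KU hZ hU n (\<lambda>j. Z (\<tau> i j) \<omega>)
        (\<lambda>j. D (\<tau> i j) \<omega>) 1 (Z i \<omega>) u"
      using loo_estimator_permute[OF perm[OF i], of L w ZZ KZ KU hZ hU "\<lambda>j. Z j \<omega>" "\<lambda>j. D j \<omega>" 1]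
      unfolding est_def \<tau>_one .
    also have "\<dots> = e (\<lambda>j\<in>?I. X (\<tau> i j) \<omega>) u"
      using one perm[OF i] unfolding e_def by (auto simp: X_def \<tau>_one[simplified] intro!: loo_estimator_cong)
    finally show "est i \<omega> u = e (\<lambda>j\<in>?I. X (\<tau> i j) \<omega>) u" .
  qed

  define sq where "sq i \<omega> = (\<integral>\<^sup>+u. ennreal ((est i \<omega> u)\<^sup>2) \<partial>leb_bar L)" for i \<omega>
  define pt where "pt i \<omega> = (\<integral>\<^sup>+u. ennreal (est i \<omega> u) \<partial>weighted_measure L w (D i \<omega>))" for i \<omega>
  define cross where "cross \<omega> = (\<integral>\<^sup>+u. ennreal (lam (Z 1 \<omega>) u) * ennreal (est 1 \<omega> u) \<partial>leb_bar L)" for \<omega>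
  define lsq where "lsq \<omega> = (\<integral>\<^sup>+u. ennreal ((lam (Z 1 \<omega>) u)\<^sup>2) \<partial>leb_bar L)" for \<omega>

  \<comment> \<open>Exchangeability applies to functionals of the sample; these two represent \<open>sq\<close> and \<open>pt\<close>.\<close>
  define esq where "esq xs = (\<integral>\<^sup>+u. ennreal ((e xs u)\<^sup>2) \<partial>leb_bar L)" for xs
  define ept where "ept xs = (\<integral>\<^sup>+u. ennreal (e xs u) \<partial>weighted_measure L w (snd (xs 1)))" for xs
  have [measurable]: "(\<lambda>xs. xs 1) \<in> measurable ?P ?S"
    by (rule measurable_component_singleton[OF one])
  have esq_meas [measurable]: "esq \<in> borel_measurable ?P"
    unfolding esq_def by (rule measurable_nn_integral_leb_bar, unfold case_prod_beta, measurable)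
  have ept_meas [measurable]: "ept \<in> borel_measurable ?P"
    unfolding ept_def
  proof (rule measurable_nn_integral_weighted_measure[OF L w])
    show "(\<lambda>(xs, u). ennreal (e xs u)) \<in> borel_measurable (?P \<Otimes>\<^sub>M borel_bar L)"
      unfolding case_prod_beta by measurable
    show "(\<lambda>xs. snd (xs 1)) \<in> measurable ?P (dgm_space L)"
      by (rule measurable_compose[OF measurable_component_singleton[OF one] measurable_snd])
  qed
  have sq_esq: "sq i \<omega> = esq (\<lambda>j\<in>?I. X (\<tau> i j) \<omega>)" if "i \<in> ?I" for i \<omega>
    unfolding sq_def esq_def est_e[OF that] ..
  have pt_ept: "pt i \<omega> = ept (\<lambda>j\<in>?I. X (\<tau> i j) \<omega>)" if "i \<in> ?I" for i \<omega>
    using one unfolding pt_def ept_def est_e[OF that] by (simp add: X_def \<tau>_one[simplified])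
  have sq_meas [measurable]: "sq i \<in> borel_measurable M" and pt_meas [measurable]: "pt i \<in> borel_measurable M"
    if i: "i \<in> ?I" for i
    using measurable_compose[OF Xv[OF perm[OF i]] esq_meas] measurable_compose[OF Xv[OF perm[OF i]] ept_meas]
    unfolding sq_esq[OF i, abs_def] pt_ept[OF i, abs_def] .
  have exch: "(\<integral>\<^sup>+\<omega>. h (\<lambda>j\<in>?I. X (\<tau> i j) \<omega>) \<partial>M) = (\<integral>\<^sup>+\<omega>. h (\<lambda>j\<in>?I. X (\<tau> 1 j) \<omega>) \<partial>M)"
    if i: "i \<in> ?I" and h: "h \<in> borel_measurable ?P" for i h
  proof -
    have law: "distr M ?S (X j) = distr M ?S (X 1)" if "j \<in> ?I" for j
      unfolding X_def[abs_def] by (rule ident[OF that])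
    show ?thesis
      using nn_integral_iid_permute[OF indepX law perm[OF i] _ h] one by (simp only: \<tau>_id) blast
  qed
  have sq_int: "(\<integral>\<^sup>+\<omega>. sq i \<omega> \<partial>M) = (\<integral>\<^sup>+\<omega>. sq 1 \<omega> \<partial>M)" if "i \<in> ?I" for i
    unfolding sq_esq[OF that] sq_esq[OF one] by (rule exch[OF that esq_meas])
  have pt_int1: "(\<integral>\<^sup>+\<omega>. pt i \<omega> \<partial>M) = (\<integral>\<^sup>+\<omega>. pt 1 \<omega> \<partial>M)" if "i \<in> ?I" for i
    unfolding pt_ept[OF that] pt_ept[OF one] by (rule exch[OF that ept_meas])
  have "(\<integral>\<^sup>+\<omega>. pt 1 \<omega> \<partial>M) = (\<integral>\<^sup>+\<omega>. cross \<omega> \<partial>M)"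
    unfolding pt_def cross_def est_def
    by (rule nn_integral_loo_estimator_cond_mean[OF \<open>prob_space M\<close> L w ZZ indep KZ KU one
        cond_mean[OF one] lam_meas lam_density lam_fin])
  then have pt_int: "(\<integral>\<^sup>+\<omega>. pt i \<omega> \<partial>M) = (\<integral>\<^sup>+\<omega>. cross \<omega> \<partial>M)" if "i \<in> ?I" for i
    using pt_int1[OF that] by simp

  have lamZ [measurable]: "(\<lambda>p. lam (Z 1 (fst p)) (snd p)) \<in> borel_measurable (M \<Otimes>\<^sub>M borel_bar L)"
  proof -
    have "(\<lambda>p. (Z 1 (fst p), snd p)) \<in> measurable (M \<Otimes>\<^sub>M borel_bar L) (restrict_space borel ZZ \<Otimes>\<^sub>M borel_bar L)"
      using one by measurable
    from measurable_compose[OF this lam_meas] show ?thesis by simp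
  qed
  have estM [measurable]: "(\<lambda>p. est 1 (fst p) (snd p)) \<in> borel_measurable (M \<Otimes>\<^sub>M borel_bar L)"
  proof -
    have "(\<lambda>p. (\<lambda>j\<in>?I. X (\<tau> 1 j) (fst p), snd p)) \<in> measurable (M \<Otimes>\<^sub>M borel_bar L) (?P \<Otimes>\<^sub>M borel_bar L)"
      by (intro measurable_Pair measurable_compose[OF measurable_fst Xv] perm one measurable_snd)
    from measurable_compose[OF this e_meas] show ?thesis unfolding est_e[OF one] by simp
  qed
  have sec: "est 1 \<omega> \<in> borel_measurable (leb_bar L)" "lam (Z 1 \<omega>) \<in> borel_measurable (leb_bar L)"
    if "\<omega> \<in> space M" for \<omega>
    using measurable_Pair2[OF estM that] measurable_Pair2[OF lamZ that]
    by (simp_all add: measurable_cong_sets[OF sets_leb_bar refl])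
  have cross_meas [measurable]: "cross \<in> borel_measurable M" and lsq_meas [measurable]: "lsq \<in> borel_measurable M"
    unfolding cross_def lsq_def by (rule measurable_nn_integral_leb_bar, unfold case_prod_beta, measurable)+

  have sq_fin: "(\<integral>\<^sup>+\<omega>. sq 1 \<omega> \<partial>M) < \<infinity>" using est_fin by (simp add: sq_def est_def)
  have lsq_fin: "(\<integral>\<^sup>+\<omega>. lsq \<omega> \<partial>M) < \<infinity>" using lam_fin by (simp add: lsq_def)
  \<comment> \<open>The bound by two terms of finite expectation makes the cross term integrable.\<close>
  have cross_le: "cross \<omega> \<le> sq 1 \<omega> + lsq \<omega>" if "\<omega> \<in> space M" for \<omega>
  proof -
    have "cross \<omega> \<le> (\<integral>\<^sup>+u. ennreal ((est 1 \<omega> u)\<^sup>2) + ennreal ((lam (Z 1 \<omega>) u)\<^sup>2) \<partial>leb_bar L)"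
      unfolding cross_def by (intro nn_integral_mono mult_le_sum_power2)
    also have "\<dots> = sq 1 \<omega> + lsq \<omega>"
      unfolding sq_def lsq_def
      by (intro nn_integral_add measurable_compose[OF _ measurable_ennreal] borel_measurable_power sec that)
    finally show ?thesis .
  qed
  have "(\<integral>\<^sup>+\<omega>. cross \<omega> \<partial>M) \<le> (\<integral>\<^sup>+\<omega>. sq 1 \<omega> + lsq \<omega> \<partial>M)"
    by (intro nn_integral_mono cross_le)
  also have "\<dots> < \<infinity>" using sq_fin lsq_fin one by (subst nn_integral_add) auto
  finally have cross_fin: "(\<integral>\<^sup>+\<omega>. cross \<omega> \<partial>M) < \<infinity>" .

  have sq_I: "integrable M (\<lambda>\<omega>. enn2real (sq i \<omega>))"
    "(\<integral>\<omega>. enn2real (sq i \<omega>) \<partial>M) = enn2real (\<integral>\<^sup>+\<omega>. sq 1 \<omega> \<partial>M)" if "i \<in> ?I" for i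
    using integral_enn2real[OF sq_meas[OF that]] sq_fin by (simp_all add: sq_int[OF that])
  have pt_I: "integrable M (\<lambda>\<omega>. enn2real (pt i \<omega>))"
    "(\<integral>\<omega>. enn2real (pt i \<omega>) \<partial>M) = enn2real (\<integral>\<^sup>+\<omega>. cross \<omega> \<partial>M)" if "i \<in> ?I" for i
    using integral_enn2real[OF pt_meas[OF that]] cross_fin by (simp_all add: pt_int[OF that])
  note cross_I = integral_enn2real[OF cross_meas cross_fin]
  note lsq_I = integral_enn2real[OF lsq_meas lsq_fin]

  have CV_eq: "CV L w ZZ KZ KU hZ hU n (\<lambda>j. Z j \<omega>) (\<lambda>j. D j \<omega>) =
      (\<Sum>i\<in>?I. enn2real (sq i \<omega>) - 2 * enn2real (pt i \<omega>)) / real n" if \<omega>: "\<omega> \<in> space M" for \<omega>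
  proof -
    have "(\<integral>u. (est i \<omega> u)\<^sup>2 \<partial>leb_bar L) = enn2real (sq i \<omega>) \<and>
        (\<integral>u. est i \<omega> u \<partial>weighted_measure L w (D i \<omega>)) = enn2real (pt i \<omega>)" if i: "i \<in> ?I" for i
    proof -
      have "est i \<omega> \<in> borel_measurable (borel_bar L)"
        using measurable_Pair2[OF e_meas measurable_space[OF Xv[OF perm[OF i]] \<omega>]] by (simp add: est_e[OF i])
      then have "est i \<omega> \<in> borel_measurable (leb_bar L)"
        "est i \<omega> \<in> borel_measurable (weighted_measure L w (D i \<omega>))"
        by (simp_all add: measurable_cong_sets[OF sets_leb_bar refl]
            measurable_cong_sets[OF sets_weighted_measure refl])
      then show ?thesis
        unfolding sq_def pt_def by (auto intro!: integral_eq_nn_integral simp: est_nonneg)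
    qed
    then show ?thesis
      unfolding CV_def est_def[symmetric] by (intro arg_cong2[of _ _ _ _ "(/)"] sum.cong) auto
  qed
  have "integrable M (\<lambda>\<omega>. (\<Sum>i\<in>?I. enn2real (sq i \<omega>) - 2 * enn2real (pt i \<omega>)) / real n)"
    by (intro integrable_divide Bochner_Integration.integrable_sum Bochner_Integration.integrable_diff
        integrable_mult_right sq_I pt_I)
  then have CV_int: "integrable M (\<lambda>\<omega>. CV L w ZZ KZ KU hZ hU n (\<lambda>j. Z j \<omega>) (\<lambda>j. D j \<omega>))"
    using CV_eq by (simp cong: Bochner_Integration.integrable_cong)
  have "(\<integral>\<omega>. CV L w ZZ KZ KU hZ hU n (\<lambda>j. Z j \<omega>) (\<lambda>j. D j \<omega>) \<partial>M) =
      (\<integral>\<omega>. (\<Sum>i\<in>?I. enn2real (sq i \<omega>) - 2 * enn2real (pt i \<omega>)) / real n \<partial>M)"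
    by (intro Bochner_Integration.integral_cong refl CV_eq)
  also have "\<dots> = (\<Sum>i\<in>?I. \<integral>\<omega>. enn2real (sq i \<omega>) - 2 * enn2real (pt i \<omega>) \<partial>M) / real n"
    unfolding integral_divide_zero
    by (subst Bochner_Integration.integral_sum)
       (auto intro!: Bochner_Integration.integrable_diff integrable_mult_right sq_I pt_I)
  also have "\<dots> = (\<Sum>i\<in>?I. enn2real (\<integral>\<^sup>+\<omega>. sq 1 \<omega> \<partial>M) - 2 * enn2real (\<integral>\<^sup>+\<omega>. cross \<omega> \<partial>M)) / real n"
    by (intro arg_cong2[of _ _ _ _ "(/)"] sum.cong refl) (simp add: sq_I pt_I)
  also have "\<dots> = enn2real (\<integral>\<^sup>+\<omega>. sq 1 \<omega> \<partial>M) - 2 * enn2real (\<integral>\<^sup>+\<omega>. cross \<omega> \<partial>M)"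
    using \<open>n \<ge> 2\<close> by simp
  finally have CV_val: "(\<integral>\<omega>. CV L w ZZ KZ KU hZ hU n (\<lambda>j. Z j \<omega>) (\<lambda>j. D j \<omega>) \<partial>M) =
      enn2real (\<integral>\<^sup>+\<omega>. sq 1 \<omega> \<partial>M) - 2 * enn2real (\<integral>\<^sup>+\<omega>. cross \<omega> \<partial>M)" .

  have C0_val: "C0 M L Z lam = enn2real (\<integral>\<^sup>+\<omega>. lsq \<omega> \<partial>M)"
  proof -
    have "(\<integral>u. (lam (Z 1 \<omega>) u)\<^sup>2 \<partial>leb_bar L) = enn2real (lsq \<omega>)" if "\<omega> \<in> space M" for \<omega>
      unfolding lsq_def
      by (intro integral_eq_nn_integral borel_measurable_power sec that AE_I2 zero_le_power2)
    then have "C0 M L Z lam = (\<integral>\<omega>. enn2real (lsq \<omega>) \<partial>M)"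
      unfolding C0_def by (intro Bochner_Integration.integral_cong refl)
    then show ?thesis using lsq_I(2) by simp
  qed

  define loss where "loss \<omega> = (\<integral>u. (est 1 \<omega> u - lam (Z 1 \<omega>) u)\<^sup>2 \<partial>leb_bar L)" for \<omega>
  have loss_nn: "loss \<omega> = enn2real (\<integral>\<^sup>+u. ennreal ((est 1 \<omega> u - lam (Z 1 \<omega>) u)\<^sup>2) \<partial>leb_bar L)"
    if "\<omega> \<in> space M" for \<omega>
    unfolding loss_def
    by (intro integral_eq_nn_integral borel_measurable_power borel_measurable_diff sec that
        AE_I2 zero_le_power2)
  have loss_meas: "loss \<in> borel_measurable M"
  proof -
    have "(\<lambda>\<omega>. \<integral>\<^sup>+u. ennreal ((est 1 \<omega> u - lam (Z 1 \<omega>) u)\<^sup>2) \<partial>leb_bar L) \<in> borel_measurable M"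
      by (rule measurable_nn_integral_leb_bar, unfold case_prod_beta, measurable)
    then show ?thesis by (subst measurable_cong[OF loss_nn]) auto
  qed
  \<comment> \<open>The square can be expanded only where both squares have finite integral, hence almost surely.\<close>
  have "AE \<omega> in M. sq 1 \<omega> \<noteq> \<infinity>" "AE \<omega> in M. lsq \<omega> \<noteq> \<infinity>"
    by (rule nn_integral_PInf_AE[OF sq_meas[OF one] less_imp_neq[OF sq_fin]]
        nn_integral_PInf_AE[OF lsq_meas less_imp_neq[OF lsq_fin]])+
  then have loss_AE: "AE \<omega> in M. loss \<omega> = enn2real (sq 1 \<omega>) - 2 * enn2real (cross \<omega>) + enn2real (lsq \<omega>)"
    using AE_space
  proof eventually_elim
    case (elim \<omega>)
    then show ?case
      unfolding loss_def sq_def cross_def lsq_def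
      using one Z_in[OF one] lam_nonneg
      by (intro integral_power2_diff sec)
         (auto simp: est_nonneg space_restrict_space top.not_eq_extremum)
  qed
  have "risk M L w ZZ KZ KU hZ hU n Z D lam = (\<integral>\<omega>. loss \<omega> \<partial>M)"
    unfolding risk_def loss_def est_def ..
  also have "\<dots> = (\<integral>\<omega>. enn2real (sq 1 \<omega>) - 2 * enn2real (cross \<omega>) + enn2real (lsq \<omega>) \<partial>M)"
    using one by (intro integral_cong_AE loss_AE loss_meas) measurable
  also have "\<dots> = enn2real (\<integral>\<^sup>+\<omega>. sq 1 \<omega> \<partial>M) - 2 * enn2real (\<integral>\<^sup>+\<omega>. cross \<omega> \<partial>M) + enn2real (\<integral>\<^sup>+\<omega>. lsq \<omega> \<partial>M)"
    using sq_I[OF one] cross_I lsq_I by simp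
  finally show ?thesis using CV_int CV_val C0_val by simp
qed

end
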